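(* For $n>0$ and every $r\in\{1,\dots,n\}$, the map $\Gamma$ (described in the context) is a bijection from (a) the set of nested pairs $(\mu_1,\mu_2)$ of Dyck paths with $2n$ steps, where $\mu_2$ is a steep path ending with exactly $r$ east-steps with $y$-coordinate equal to $n$, to (b) the set of nested pairs $(\mu'_1,\mu'_2)$ of Dyck paths with $2n$ steps, where $\mu'_1$ is a bounce path that touches the main diagonal $r+1$ times.
   Context: Dyck paths. A Dyck path with $2n$ steps is a lattice path from $(0,0)$ to $(n,n)$ with steps $N=(0,1)$, $E=(1,0)$ staying weakly above the main diagonal. A valley is a lattice point on the path preceded by $E$ and followed by $N$. A Dyck path is steep if it has no two consecutive east-steps before its last north-step; it is bounce if it equals $N^{i_1}E^{i_1}\cdots N^{i_s}E^{i_s}$ for positive integers $i_1,\dots,i_s$ (its contacts with the diagonal, including both endpoints, are counted). A pair $(\mu_1,\mu_2)$ of Dyck paths of the same length is nested if $\mu_1$ stays weakly below $\mu_2$. $\mathcal{SP}_n$ (resp. $\mathcal{BP}_n$) is the set of nested pairs of Dyck paths with $2n$ steps whose top path $\mu_2$ is steep (resp. whose bottom path $\mu_1$ is bounce). LAC trees. A composition of $n$ is a tuple $\alpha=(\alpha_1,\dots,\alpha_r)$ of positive integers with sum $n$; $s_0=0$, $s_i=\alpha_1+\dots+\alpha_i$; $\nu_\alpha=N^{\alpha_1}E^{\alpha_1}\cdots N^{\alpha_r}E^{\alpha_r}$. In a plane rooted tree the children of each node are linearly ordered from left to right; the LR-prefix order lists nodes by first visit in the depth-first search from the root visiting children from left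 to right. An internal node is neither the root nor a leaf. Let $T$ be a plane rooted tree with $n$ non-root nodes. For $k=1,\dots,r$ perform step $k$: a non-root node is active if it is not yet colored and its parent is the root or an already colored node; if there are fewer than $\alpha_k$ active nodes, fail; otherwise give color $k$ to the first $\alpha_k$ of the active nodes (as determined at the beginning of the step) in LR-prefix order. If this never fails, $T$ is an $\alpha$-tree, with the resulting left-aligned coloring. A LAC tree of size $n$ is a pair $(T,\alpha)$ with $\alpha$ a composition of $n$ and $T$ an $\alpha$-tree; $LAC_n$ is the set of these. Map $\Xi_{\mathrm{steep}}:LAC_n\to\mathcal{SP}_n$. Given $(T,\alpha)$, traverse $T$ by depth-first search from the root visiting children from right to left. Each time a new non-root node is visited, write $N_\bullet$ (marked north-step) if its color has not been seen before, and $N_\circ$ (unmarked) otherwise; each time one returns to an already visited node (moves back up to a parent), write $E$. From the resulting word, $\mu_1$ is obtained by forgetting the marking, and $\mu_2$ is obtained by deleting all $E$, replacing each $N_\bullet$ by $N$ and each $N_\circ$ by $EN$, and appending east-steps until $(n,n)$ is reached. Put $\Xi_{\mathrm{steep}}(T,\alpha)=(\mu_1,\mu_2)$. Map $\Xi_{\mathrm{bounce}}:LAC_n\to\mathcal{BP}_n$. Given $(T,\alpha)$, let $a_k$ be the number of active nodes at the beginning of step $k+1$ of the coloring procedure. For each internal node $u$, if $u$ is the $i$-th node of color $k$ in LR-prefix order and its rightmost child is the $j$-th active node (in LR-prefix order) at the beginning of step $k+1$, mark the point $(s_k-i+1,\ s_k+a_k-j)$. Let $\mu_T$ be the unique Dyck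 path from $(0,0)$ to $(n,n)$ whose valleys are exactly the marked points. Put $\Xi_{\mathrm{bounce}}(T,\alpha)=(\nu_\alpha,\mu_T)$. Both maps are bijections, and $\Gamma=\Xi_{\mathrm{bounce}}\circ\Xi_{\mathrm{steep}}^{-1}:\mathcal{SP}_n\to\mathcal{BP}_n$. *)

theory Defs
  imports Main
begin

section \<open>Dyck paths\<close>

datatype step = N | E

type_synonym path = "step list"

definition point_at :: "path \<Rightarrow> nat \<Rightarrow> nat \<times> nat" where
  "point_at p k = (count_list (take k p) E, count_list (take k p) N)"

definition path_points :: "path \<Rightarrow> (nat \<times> nat) set" where
  "path_points p = point_at p ` {0..length p}"

definition dyck_paths :: "nat \<Rightarrow> path set" where
  "dyck_paths n = {p. point_at p (length p) = (n, n) \<and> (\<forall>(x, y) \<in> path_points p. x \<le> y)}"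

definition valleys :: "path \<Rightarrow> (nat \<times> nat) set" where
  "valleys p = {point_at p k |k. 0 < k \<and> k < length p \<and> p ! (k - 1) = E \<and> p ! k = N}"

definition steep :: "path \<Rightarrow> bool" where
  "steep p \<longleftrightarrow> \<not> (\<exists>xs ys. p = xs @ [E, E] @ ys \<and> N \<in> set ys)"

definition bounce_path :: "nat list \<Rightarrow> path" where
  "bounce_path \<alpha> = concat (map (\<lambda>i. replicate i N @ replicate i E) \<alpha>)"

definition bounce :: "path \<Rightarrow> bool" where
  "bounce p \<longleftrightarrow> (\<exists>is. (\<forall>i \<in> set is. 0 < i) \<and> p = bounce_path is)"

definition diagonal_contacts :: "path \<Rightarrow> nat" where
  "diagonal_contacts p = card {(x, y) \<in> path_points p. x = y}"

definition east_steps_at_height :: "nat \<Rightarrow> path \<Rightarrow> nat" where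
  "east_steps_at_height h p = card {k. k < length p \<and> p ! k = E \<and> snd (point_at p k) = h}"

definition nested :: "path \<Rightarrow> path \<Rightarrow> bool" where
  "nested \<mu>1 \<mu>2 \<longleftrightarrow> (\<forall>(x, y) \<in> path_points \<mu>1. \<exists>y'. (x, y') \<in> path_points \<mu>2 \<and> y \<le> y')"

definition nested_pairs :: "nat \<Rightarrow> (path \<times> path) set" where
  "nested_pairs n = {(\<mu>1, \<mu>2). \<mu>1 \<in> dyck_paths n \<and> \<mu>2 \<in> dyck_paths n \<and> nested \<mu>1 \<mu>2}"

definition SP :: "nat \<Rightarrow> (path \<times> path) set" where
  "SP n = {(\<mu>1, \<mu>2) \<in> nested_pairs n. steep \<mu>2}"

definition BP :: "nat \<Rightarrow> (path \<times> path) set" where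
  "BP n = {(\<mu>1, \<mu>2) \<in> nested_pairs n. bounce \<mu>1}"


section \<open>Plane rooted trees\<close>

datatype ptree = Node "ptree list"

text \<open>
  A node is identified with its address: the root is \<open>[]\<close>, and \<open>u @ [i]\<close> is the child of \<open>u\<close>
  with exactly \<open>i\<close> siblings to its left. Hence the parent of a non-root node \<open>u\<close> is \<open>butlast u\<close>.
\<close>

type_synonym node = "nat list"

text \<open>All nodes, in LR-prefix order.\<close>

primrec preorder :: "ptree \<Rightarrow> node list" where
  "preorder (Node ts) =
     [] # concat (map2 (\<lambda>i us. map ((#) i) us) [0..<length ts] (map preorder ts))"

definition nonroot_nodes :: "ptree \<Rightarrow> node set" where
  "nonroot_nodes T = set (preorder T) - {[]}"

text \<open>The children of a node, from left to right.\<close>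

definition children :: "ptree \<Rightarrow> node \<Rightarrow> node list" where
  "children T u = filter (\<lambda>v. v \<noteq> [] \<and> butlast v = u) (preorder T)"

definition internal_nodes :: "ptree \<Rightarrow> node set" where
  "internal_nodes T = {u \<in> nonroot_nodes T. children T u \<noteq> []}"


section \<open>LAC trees\<close>

definition compositions :: "nat \<Rightarrow> nat list set" where
  "compositions n = {\<alpha>. (\<forall>a \<in> set \<alpha>. 0 < a) \<and> sum_list \<alpha> = n}"

text \<open>The active nodes in LR-prefix order, when \<open>C\<close> is the set of already colored nodes.\<close>

definition active :: "ptree \<Rightarrow> node set \<Rightarrow> node list" where
  "active T C = filter (\<lambda>u. u \<noteq> [] \<and> u \<notin> C \<and> (butlast u = [] \<or> butlast u \<in> C)) (preorder T)"

text \<open>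
  The nodes colored after \<open>k\<close> steps. Parts of \<open>\<alpha>\<close> are indexed from 0 in lists, so that step
  \<open>k + 1\<close> uses \<open>\<alpha> ! k\<close>. Failure of the procedure is recorded separately, by \<open>alpha_tree\<close>.
\<close>

primrec colored :: "ptree \<Rightarrow> nat list \<Rightarrow> nat \<Rightarrow> node set" where
  "colored T \<alpha> 0 = {}"
| "colored T \<alpha> (Suc k) = colored T \<alpha> k \<union> set (take (\<alpha> ! k) (active T (colored T \<alpha> k)))"

definition active_after :: "ptree \<Rightarrow> nat list \<Rightarrow> nat \<Rightarrow> node list" where
  "active_after T \<alpha> k = active T (colored T \<alpha> k)"

definition alpha_tree :: "nat list \<Rightarrow> ptree \<Rightarrow> bool" where
  "alpha_tree \<alpha> T \<longleftrightarrow> card (nonroot_nodes T) = sum_list \<alpha> \<and>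
     (\<forall>k < length \<alpha>. \<alpha> ! k \<le> length (active_after T \<alpha> k))"

definition LAC :: "nat \<Rightarrow> (ptree \<times> nat list) set" where
  "LAC n = {(T, \<alpha>). \<alpha> \<in> compositions n \<and> alpha_tree \<alpha> T}"

text \<open>The color of a node is the step in which it gets colored.\<close>

definition color :: "ptree \<Rightarrow> nat list \<Rightarrow> node \<Rightarrow> nat" where
  "color T \<alpha> u = (LEAST k. u \<in> colored T \<alpha> k)"

text \<open>The nodes of color \<open>k\<close> in LR-prefix order.\<close>

definition color_class :: "ptree \<Rightarrow> nat list \<Rightarrow> nat \<Rightarrow> node list" where
  "color_class T \<alpha> k = filter (\<lambda>u. u \<noteq> [] \<and> color T \<alpha> u = k) (preorder T)"


section \<open>The map to pairs with steep top path\<close>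

datatype move = Visit node | Return

text \<open>The right-to-left depth-first traversal of a tree, without the initial visit of the root.\<close>

fun in_child :: "nat \<Rightarrow> move \<Rightarrow> move" where
  "in_child i (Visit u) = Visit (i # u)"
| "in_child i Return = Return"

primrec traversal_RL :: "ptree \<Rightarrow> move list" where
  "traversal_RL (Node ts) =
     concat (rev (map2 (\<lambda>i w. [Visit [i]] @ map (in_child i) w @ [Return])
                       [0..<length ts] (map traversal_RL ts)))"

datatype marked_step = N_marked | N_unmarked | E_step

text \<open>The set argument accumulates the colors already seen.\<close>

fun mark_moves :: "(node \<Rightarrow> nat) \<Rightarrow> nat set \<Rightarrow> move list \<Rightarrow> marked_step list" where
  "mark_moves c S [] = []"
| "mark_moves c S (Visit u # w) =
     (if c u \<in> S then N_unmarked else N_marked) # mark_moves c (insert (c u) S) w"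
| "mark_moves c S (Return # w) = E_step # mark_moves c S w"

definition marked_word :: "ptree \<Rightarrow> nat list \<Rightarrow> marked_step list" where
  "marked_word T \<alpha> = mark_moves (color T \<alpha>) {} (traversal_RL T)"

fun forget_marking :: "marked_step \<Rightarrow> step" where
  "forget_marking N_marked = N"
| "forget_marking N_unmarked = N"
| "forget_marking E_step = E"

fun top_steps :: "marked_step \<Rightarrow> path" where
  "top_steps N_marked = [N]"
| "top_steps N_unmarked = [E, N]"
| "top_steps E_step = []"

definition complete_east :: "path \<Rightarrow> path" where
  "complete_east p = p @ replicate (count_list p N - count_list p E) E"

definition Xi_steep :: "ptree \<times> nat list \<Rightarrow> path \<times> path" where
  "Xi_steep = (\<lambda>(T, \<alpha>).
     (map forget_marking (marked_word T \<alpha>),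
      complete_east (concat (map top_steps (marked_word T \<alpha>)))))"


section \<open>The map to pairs with bounce bottom path\<close>

text \<open>
  In the list encoding the \<open>i\<close>-th entry is \<open>_ ! (i - 1)\<close>. All subtractions below are exact, since
  \<open>i \<le> \<alpha>\<^sub>k \<le> s\<^sub>k\<close> and \<open>j \<le> a\<^sub>k\<close> for an \<open>\<alpha>\<close>-tree.
\<close>

definition marked_points :: "ptree \<Rightarrow> nat list \<Rightarrow> (nat \<times> nat) set" where
  "marked_points T \<alpha> =
     {(s - i + 1, s + a - j) |k i j s a u.
        k \<in> {1..length \<alpha>} \<and> s = sum_list (take k \<alpha>) \<and> a = length (active_after T \<alpha> k) \<and>
        u \<in> internal_nodes T \<and>
        i \<in> {1..length (color_class T \<alpha> k)} \<and> color_class T \<alpha> k ! (i - 1) = u \<and>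
        j \<in> {1..a} \<and> active_after T \<alpha> k ! (j - 1) = last (children T u)}"

definition tree_path :: "nat \<Rightarrow> ptree \<Rightarrow> nat list \<Rightarrow> path" where
  "tree_path n T \<alpha> = (THE p. p \<in> dyck_paths n \<and> valleys p = marked_points T \<alpha>)"

definition Xi_bounce :: "ptree \<times> nat list \<Rightarrow> path \<times> path" where
  "Xi_bounce = (\<lambda>(T, \<alpha>). (bounce_path \<alpha>, tree_path (sum_list \<alpha>) T \<alpha>))"

definition Gamma_map :: "nat \<Rightarrow> path \<times> path \<Rightarrow> path \<times> path" where
  "Gamma_map n = Xi_bounce \<circ> inv_into (LAC n) Xi_steep"

end

theory Submission
  imports Defs "HOL-Library.List_Lexorder" "HOL-Library.Sublist"
begin

text \<open>
  The state of the coloring procedure is the list \<open>F\<close> of subtrees hanging from the active nodes: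
  coloring \<open>a\<close> nodes replaces the first \<open>a\<close> trees of \<open>F\<close> by their children.

  On the bounce side, listing the degrees of the root and then of the nodes, by increasing color and
  from right to left within a color, gives the numbers of north-steps before the successive
  east-steps of \<open>\<mu>\<^sub>T\<close>. The procedure does not fail exactly when this path stays above
  \<open>\<nu>\<^sub>\<alpha>\<close>, and it can be run backwards from \<open>\<alpha>\<close> and the degrees.

  On the steep side, the marked nodes are the last nodes of the color classes in LR-prefix order, so
  a step of the procedure colors the active nodes up to the first marked one, and the marking
  determines \<open>\<alpha>\<close>. Such a step preserves, after each of the remaining letters of the marked word,
  the number of east-steps minus the number of unmarked north-steps. A tree with marked nodes hence
  comes from a LAC tree iff this number never becomes negative, that is, iff \<open>\<mu>\<^sub>1\<close> stays
  below \<open>\<mu>\<^sub>2\<close>.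
\<close>

section \<open>Paths encoded by their runs of north-steps\<close>

text \<open>Both statistics equal the number of parts of \<alpha>. The word \<open>top_word\<close>
  has one east-step for each unmarked node, so its completion adds as many east-steps at height n as
  there are marked nodes, that is, one per color; and \<open>bounce_path \<alpha>\<close> meets the
  diagonal at the origin and after each part. The theorem thus restricts two bijections to the LAC
  trees with r colors, and nearly all of the work lies in the bijectivity. The obstacle is that both
  maps speak of node addresses and of a growing set of colored nodes. This set is closed under
  ancestors, so the active nodes form an antichain, and the order between two of them extends to
  their descendants. Replacing colored nodes in place by their children is therefore compatible with
  LR-prefix order, which is what makes a recursion on lists of subtrees, free of addresses,
  possible. On an antichain a right-to-left traversal also reverses LR-prefix order, so that the
  first visited node of a color is the last one of its class.\<close>

lemma path_points_iff:
  "(x, y) \<in> path_points p \<longleftrightarrow> (\<exists>u v. p = u @ v \<and> x = count_list u E \<and> y = count_list u N)"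
proof
  assume "(x, y) \<in> path_points p"
  then obtain k where "k \<le> length p" "(x, y) = point_at p k"
    by (auto simp: path_points_def)
  then show "\<exists>u v. p = u @ v \<and> x = count_list u E \<and> y = count_list u N"
    by (intro exI[of _ "take k p"] exI[of _ "drop k p"]) (simp add: point_at_def)
next
  assume "\<exists>u v. p = u @ v \<and> x = count_list u E \<and> y = count_list u N"
  then obtain u v where uv: "p = u @ v" "x = count_list u E" "y = count_list u N"
    by blast
  then have "(x, y) = point_at p (length u)" "length u \<le> length p"
    by (simp_all add: point_at_def)
  then show "(x, y) \<in> path_points p"
    unfolding path_points_def by auto
qed

lemma path_points_Nil [simp]: "path_points [] = {(0, 0)}"
  by (auto simp: path_points_def point_at_def)

text \<open>The parameter \<open>f\<close> lets one case split on the prefix \<open>u\<close> serve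
  both points (\<open>f v = v\<close>) and valleys (\<open>f v = E # N # v\<close>).\<close>

lemma ex_append_Cons_iff:
  "(\<exists>u v. s # p = u @ f v \<and> P u) \<longleftrightarrow> (\<exists>v. s # p = f v \<and> P []) \<or> (\<exists>u v. p = u @ f v \<and> P (s # u))"
    (is "?l \<longleftrightarrow> ?r")
proof
  assume ?l
  then obtain u v where "s # p = u @ f v" "P u" by blast
  then show ?r by (cases u) auto
next
  assume ?r
  then show ?l by (metis append_Cons append_Nil)
qed

lemma path_points_N:
  "(x, y) \<in> path_points (N # p) \<longleftrightarrow>
     x = 0 \<and> y = 0 \<or> (\<exists>y'. y = Suc y' \<and> (x, y') \<in> path_points p)"
  unfolding path_points_iff ex_append_Cons_iff[where f = "\<lambda>v. v"] by auto

lemma path_points_E: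
  "(x, y) \<in> path_points (E # p) \<longleftrightarrow>
     x = 0 \<and> y = 0 \<or> (\<exists>x'. x = Suc x' \<and> (x', y) \<in> path_points p)"
  unfolding path_points_iff ex_append_Cons_iff[where f = "\<lambda>v. v"] by auto

lemma path_points_replicate_N:
  "(x, y) \<in> path_points (replicate d N @ p) \<longleftrightarrow>
     x = 0 \<and> y < d \<or> (\<exists>y'. y = d + y' \<and> (x, y') \<in> path_points p)"
proof (induction d arbitrary: y)
  case (Suc d)
  then show ?case by (cases y) (auto simp: path_points_N)
qed simp

lemma path_points_replicate_E:
  "(x, y) \<in> path_points (replicate d E @ p) \<longleftrightarrow>
     x < d \<and> y = 0 \<or> (\<exists>x'. x = d + x' \<and> (x', y) \<in> path_points p)"
proof (induction d arbitrary: x)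
  case (Suc d)
  then show ?case by (cases x) (auto simp: path_points_E)
qed simp

lemma count_list_replicate_step [simp]:
  "count_list (replicate d x) y = (if x = y then d else 0)"
  by (induction d) auto

lemma dyck_paths_iff:
  "p \<in> dyck_paths n \<longleftrightarrow> count_list p E = n \<and> count_list p N = n \<and>
     (\<forall>u v. p = u @ v \<longrightarrow> count_list u E \<le> count_list u N)"
proof -
  have "(\<forall>(x, y) \<in> path_points p. x \<le> y) \<longleftrightarrow> (\<forall>x y. (x, y) \<in> path_points p \<longrightarrow> x \<le> y)"
    by auto
  then show ?thesis
    unfolding dyck_paths_def by (simp add: path_points_iff point_at_def) blast
qed

text \<open>
  A path ending with an east-step is encoded by the numbers \<open>ds\<close> of north-steps immediately
  preceding each of its east-steps; the \<open>x\<close>-th east-step then has height \<open>sum_list (take x ds)\<close>.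
\<close>

fun column_path :: "nat list \<Rightarrow> path" where
  "column_path [] = []"
| "column_path (d # ds) = replicate d N @ E # column_path ds"

lemma column_path_append: "column_path (ds @ es) = column_path ds @ column_path es"
  by (induction ds) auto

lemma column_path_inject: "column_path ds = column_path es \<longleftrightarrow> ds = es"
proof (induction ds arbitrary: es)
  case Nil
  then show ?case by (cases es) auto
next
  case (Cons d ds)
  have aux: "replicate d N @ E # p = replicate e N @ E # q \<longleftrightarrow> d = e \<and> p = q" for d e p q
  proof (induction d arbitrary: e)
    case 0
    then show ?case by (cases e) auto
  next
    case (Suc d)
    then show ?case by (cases e) auto
  qed
  show ?case
  proof (cases es)
    case Nil
    then show ?thesis by simp
  next
    case (Cons e es')
    then show ?thesis using aux Cons.IH by simp
  qed
qed

lemma count_list_column_path [simp]: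
  "count_list (column_path ds) E = length ds" "count_list (column_path ds) N = sum_list ds"
  by (induction ds) auto

lemma ex_column_path:
  assumes "p = [] \<or> last p = E"
  shows "\<exists>ds. p = column_path ds"
  using assms
proof (induction p)
  case Nil
  then show ?case by (intro exI[of _ "[]"]) simp
next
  case (Cons s p)
  then obtain ds where ds: "p = column_path ds"
    by (cases p) auto
  show ?case
  proof (cases s)
    case E
    then show ?thesis using ds by (intro exI[of _ "0 # ds"]) simp
  next
    case N
    then have "p \<noteq> []" using Cons.prems by auto
    then obtain d ds' where "ds = d # ds'" using ds by (cases ds) auto
    then show ?thesis using ds N by (intro exI[of _ "Suc d # ds'"]) simp
  qed
qed

text \<open>At \<open>x = length ds\<close> both occurrences of \<open>take\<close> return the whole
  list, so the formula for a vertical segment also covers the endpoint.\<close>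

lemma path_points_column_path:
  "(x, y) \<in> path_points (column_path ds) \<longleftrightarrow>
     x \<le> length ds \<and> sum_list (take x ds) \<le> y \<and> y \<le> sum_list (take (Suc x) ds)"
proof (induction ds arbitrary: x y)
  case Nil
  then show ?case by auto
next
  case (Cons d ds)
  have "(x, y) \<in> path_points (column_path (d # ds)) \<longleftrightarrow>
      x = 0 \<and> y \<le> d \<or> (\<exists>x' y'. x = Suc x' \<and> y = d + y' \<and> (x', y') \<in> path_points (column_path ds))"
    by (force simp: path_points_replicate_N path_points_E)
  also have "\<dots> \<longleftrightarrow> x \<le> length (d # ds) \<and> sum_list (take x (d # ds)) \<le> y \<and>
      y \<le> sum_list (take (Suc x) (d # ds))"
    unfolding Cons.IH by (cases x) (auto simp: le_iff_add)
  finally show ?case .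
qed

lemma sum_list_take_mono: "x \<le> x' \<Longrightarrow> sum_list (take x ds) \<le> sum_list (take x' (ds :: nat list))"
  by (metis le_add1 le_add_diff_inverse sum_list.append take_add)

lemma sum_list_take_Suc:
  "x < length ds \<Longrightarrow> sum_list (take (Suc x) ds) = sum_list (take x ds) + (ds ! x :: nat)"
  by (simp add: take_Suc_conv_app_nth)

lemma column_path_dyck_iff:
  "column_path ds \<in> dyck_paths n \<longleftrightarrow>
     length ds = n \<and> sum_list ds = n \<and> (\<forall>x \<le> n. x \<le> sum_list (take x ds))"
proof -
  have "(\<forall>(x, y) \<in> path_points (column_path ds). x \<le> y) \<longleftrightarrow>
      (\<forall>x y. (x, y) \<in> path_points (column_path ds) \<longrightarrow> x \<le> y)"
    by auto
  also have "\<dots> \<longleftrightarrow> (\<forall>x \<le> length ds. x \<le> sum_list (take x ds))"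
    unfolding path_points_column_path
    by (meson le_refl le_trans le_SucI sum_list_take_mono)
  finally show ?thesis
    unfolding dyck_paths_def by (auto simp: point_at_def)
qed

lemma dyck_path_column_path:
  assumes "p \<in> dyck_paths n"
  obtains ds where "p = column_path ds"
proof -
  have "last p = E" if "p \<noteq> []"
  proof (rule ccontr)
    assume "last p \<noteq> E"
    then have "last p = N" by (cases "last p") auto
    with that have p: "p = butlast p @ [N]"
      by (metis append_butlast_last_id)
    then have "count_list (butlast p) E \<le> count_list (butlast p) N"
      using assms unfolding dyck_paths_iff by metis
    moreover have "count_list p E = count_list (butlast p) E"
        "count_list p N = Suc (count_list (butlast p) N)"
      by (subst p; simp)+
    ultimately show False
      using assms by (simp add: dyck_paths_iff)
  qed
  then show ?thesis
    using ex_column_path that by blast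
qed

text \<open>Only the highest point of each column matters, and in column \<open>x\<close> it is the
  partial sum of length \<open>Suc x\<close>; hence the shift by one in the proof. In the last
  column the equality of the totals takes over.\<close>

lemma nested_column_path_iff:
  assumes "length ds = length es" and "sum_list ds = sum_list es"
  shows "nested (column_path ds) (column_path es) \<longleftrightarrow>
    (\<forall>x \<le> length ds. sum_list (take x ds) \<le> sum_list (take x es))"
proof
  assume *: "nested (column_path ds) (column_path es)"
  show "\<forall>x \<le> length ds. sum_list (take x ds) \<le> sum_list (take x es)"
  proof (intro allI impI)
    fix x assume x: "x \<le> length ds"
    show "sum_list (take x ds) \<le> sum_list (take x es)"
    proof (cases x)
      case (Suc x')
      have "(x', sum_list (take x ds)) \<in> path_points (column_path ds)"
        using x Suc by (simp add: path_points_column_path sum_list_take_mono)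
      then obtain y' where "(x', y') \<in> path_points (column_path es)" "sum_list (take x ds) \<le> y'"
        using * unfolding nested_def by fastforce
      then show ?thesis
        using Suc by (simp add: path_points_column_path)
    qed simp
  qed
next
  assume *: "\<forall>x \<le> length ds. sum_list (take x ds) \<le> sum_list (take x es)"
  show "nested (column_path ds) (column_path es)"
    unfolding nested_def
  proof (clarify)
    fix x y assume "(x, y) \<in> path_points (column_path ds)"
    then have x: "x \<le> length ds" and y: "y \<le> sum_list (take (Suc x) ds)"
      by (simp_all add: path_points_column_path)
    have "y \<le> sum_list (take (Suc x) es)"
    proof (cases "x = length ds")
      case True
      then show ?thesis using y assms by simp
    next
      case False
      then show ?thesis using x y * by (metis Suc_leI le_neq_implies_less le_trans)
    qed
    then show "\<exists>y'. (x, y') \<in> path_points (column_path es) \<and> y \<le> y'"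
      using x assms
      by (intro exI[of _ "sum_list (take (Suc x) es)"])
        (simp add: path_points_column_path sum_list_take_mono)
  qed
qed

section \<open>Valleys, and why they determine a Dyck path\<close>

lemma valleys_iff:
  "(x, y) \<in> valleys p \<longleftrightarrow>
     (\<exists>u v. p = u @ E # N # v \<and> x = Suc (count_list u E) \<and> y = count_list u N)"
proof
  assume "(x, y) \<in> valleys p"
  then obtain k where k: "0 < k" "k < length p" "p ! (k - 1) = E" "p ! k = N" "(x, y) = point_at p k"
    unfolding valleys_def by blast
  then have take: "take k p = take (k - 1) p @ [E]"
    by (metis Suc_diff_1 less_imp_diff_less take_Suc_conv_app_nth)
  moreover have "drop k p = N # drop (Suc k) p"
    using k by (metis Cons_nth_drop_Suc)
  ultimately have "p = take (k - 1) p @ E # N # drop (Suc k) p"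
    by (metis append.assoc append_Cons append_Nil append_take_drop_id)
  moreover have "x = Suc (count_list (take (k - 1) p) E)" "y = count_list (take (k - 1) p) N"
    using k(5) take by (simp_all add: point_at_def)
  ultimately show "\<exists>u v. p = u @ E # N # v \<and> x = Suc (count_list u E) \<and> y = count_list u N"
    by blast
next
  assume "\<exists>u v. p = u @ E # N # v \<and> x = Suc (count_list u E) \<and> y = count_list u N"
  then obtain u v where uv: "p = u @ E # N # v" "x = Suc (count_list u E)" "y = count_list u N"
    by blast
  then have "(x, y) = point_at p (Suc (length u)) \<and> 0 < Suc (length u) \<and> Suc (length u) < length p
      \<and> p ! (Suc (length u) - 1) = E \<and> p ! Suc (length u) = N"
    by (simp add: point_at_def nth_append)
  then show "(x, y) \<in> valleys p"
    unfolding valleys_def by blast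
qed

lemma valleys_N: "(x, y) \<in> valleys (N # p) \<longleftrightarrow> (\<exists>y'. y = Suc y' \<and> (x, y') \<in> valleys p)"
  unfolding valleys_iff ex_append_Cons_iff by auto

lemma valleys_replicate_N:
  "(x, y) \<in> valleys (replicate d N @ p) \<longleftrightarrow> (\<exists>y'. y = d + y' \<and> (x, y') \<in> valleys p)"
  by (induction d arbitrary: y) (auto simp: valleys_N)

lemma valleys_E:
  "(x, y) \<in> valleys (E # p) \<longleftrightarrow>
     x = 1 \<and> y = 0 \<and> (\<exists>q. p = N # q) \<or> (\<exists>x'. x = Suc x' \<and> (x', y) \<in> valleys p)"
  unfolding valleys_iff ex_append_Cons_iff by auto

lemma valleys_column_path:
  "(x, y) \<in> valleys (column_path ds) \<longleftrightarrow>
     0 < x \<and> x < length ds \<and> 0 < ds ! x \<and> y = sum_list (take x ds)"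
proof (induction ds arbitrary: x y)
  case Nil
  then show ?case by (auto simp: valleys_iff)
next
  case (Cons d ds)
  have starts: "(\<exists>q. column_path ds = N # q) \<longleftrightarrow> 0 < length ds \<and> 0 < ds ! 0"
  proof (cases ds)
    case (Cons e es)
    then show ?thesis by (cases e) auto
  qed simp
  have "(x, y) \<in> valleys (column_path (d # ds)) \<longleftrightarrow>
      x = 1 \<and> y = d \<and> 0 < length ds \<and> 0 < ds ! 0 \<or>
      (\<exists>x' y'. x = Suc x' \<and> y = d + y' \<and> (x', y') \<in> valleys (column_path ds))"
    by (auto simp: valleys_replicate_N valleys_E starts)
  also have "\<dots> \<longleftrightarrow> 0 < x \<and> x < length (d # ds) \<and> 0 < (d # ds) ! x \<and> y = sum_list (take x (d # ds))"
    unfolding Cons.IH by (cases x; cases "x - 1") auto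
  finally show ?case .
qed

lemma list_eq_if_take_sums_eq:
  fixes ds es :: "nat list"
  assumes "length ds = length es" and "\<And>x. x \<le> length ds \<Longrightarrow> sum_list (take x ds) = sum_list (take x es)"
  shows "ds = es"
proof (rule nth_equalityI)
  fix x assume x: "x < length ds"
  then have "sum_list (take (Suc x) ds) = sum_list (take (Suc x) es)"
    using assms(2) by simp
  then show "ds ! x = es ! x"
    using x assms(1) assms(2)[of x] by (simp add: sum_list_take_Suc)
qed fact

text \<open>The partial sums are compared downwards from \<open>n\<close>, where both equal
  \<open>n\<close>. A nonzero entry at \<open>x > 0\<close> in either list puts a valley there,
  whose height is then shared; if both entries vanish, the sums at \<open>x\<close> are those at
  \<open>Suc x\<close>.\<close>

lemma dyck_path_valleys_inject:
  assumes p: "p \<in> dyck_paths n" and q: "q \<in> dyck_paths n" and eq: "valleys p = valleys q"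
  shows "p = q"
proof -
  obtain ds where ds: "p = column_path ds" using p by (rule dyck_path_column_path)
  obtain es where es: "q = column_path es" using q by (rule dyck_path_column_path)
  have n: "length ds = n" "sum_list ds = n" "length es = n" "sum_list es = n"
    using p q ds es column_path_dyck_iff by auto
  have "sum_list (take x ds) = sum_list (take x es)" if "x \<le> n" for x
    using that
  proof (induction x rule: inc_induct)
    case base
    then show ?case using n by simp
  next
    case (step x)
    consider "x = 0" | "0 < x" "0 < ds ! x" | "0 < x" "0 < es ! x" | "ds ! x = 0" "es ! x = 0"
      by blast
    then show ?case
    proof cases
      case 2
      then have "(x, sum_list (take x ds)) \<in> valleys p"
        using step n by (simp add: ds valleys_column_path)
      then show ?thesis by (simp add: eq es valleys_column_path)
    next
      case 3
      then have "(x, sum_list (take x es)) \<in> valleys q"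
        using step n by (simp add: es valleys_column_path)
      then show ?thesis by (simp add: eq[symmetric] ds valleys_column_path)
    next
      case 4
      then show ?thesis using step n by (simp add: sum_list_take_Suc)
    qed simp
  qed
  then show ?thesis
    using n ds es list_eq_if_take_sums_eq[of ds es] by simp
qed

section \<open>Bounce paths\<close>

fun bounce_columns :: "nat list \<Rightarrow> nat list" where
  "bounce_columns [] = []"
| "bounce_columns (a # \<alpha>) = (a # replicate (a - 1) 0) @ bounce_columns \<alpha>"

lemma column_path_zeros: "column_path (replicate m 0) = replicate m E"
  by (induction m) auto

lemma bounce_path_column_path:
  assumes "\<forall>a \<in> set \<alpha>. 0 < a"
  shows "bounce_path \<alpha> = column_path (bounce_columns \<alpha>)"
  using assms
proof (induction \<alpha>)
  case Nil
  then show ?case by (simp add: bounce_path_def)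
next
  case (Cons a \<alpha>)
  have "column_path (a # replicate (a - 1) 0) = replicate a N @ replicate a E"
    using Cons.prems by (cases a) (simp_all add: column_path_zeros)
  then show ?case
    using Cons column_path_append[of "a # replicate (a - 1) 0"]
    by (simp add: bounce_path_def del: column_path.simps)
qed

lemma length_bounce_columns [simp]:
  "\<forall>a \<in> set \<alpha>. 0 < a \<Longrightarrow> length (bounce_columns \<alpha>) = sum_list \<alpha>"
  by (induction \<alpha>) auto

lemma sum_list_bounce_columns [simp]: "sum_list (bounce_columns \<alpha>) = sum_list \<alpha>"
  by (induction \<alpha>) (auto simp: sum_list_replicate)

lemma bounce_columns_inject:
  assumes "\<forall>a \<in> set \<alpha>. 0 < a" "\<forall>b \<in> set \<beta>. 0 < b" "bounce_columns \<alpha> = bounce_columns \<beta>"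
  shows "\<alpha> = \<beta>"
  using assms
proof (induction \<alpha> arbitrary: \<beta>)
  case Nil
  then show ?case by (cases \<beta>) auto
next
  case (Cons a \<alpha>)
  then obtain b \<beta>' where \<beta>: "\<beta> = b # \<beta>'"
    by (cases \<beta>) auto
  then have "a = b" "bounce_columns \<alpha> = bounce_columns \<beta>'"
    using Cons.prems(3) by auto
  moreover have "\<alpha> = \<beta>'"
    using Cons.prems(1,2) calculation(2) \<beta> by (intro Cons.IH) simp_all
  ultimately show ?case
    using \<beta> by simp
qed

lemma sum_list_replicate_zero_append:
  "sum_list (take m (replicate k (0::nat) @ xs)) = sum_list (take (m - k) xs)"
  by (simp add: take_replicate sum_list_replicate)

text \<open>Within a block the partial sums of \<open>bounce_columns \<alpha>\<close> jump at the
  first column and stay constant afterwards, while those of \<open>ds\<close> increase weakly, so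
  the first column of each block is the critical one. The offset \<open>c\<close> carries the excess
  from the blocks already treated, which the induction needs.\<close>

lemma take_bounce_columns_le_iff:
  assumes "\<forall>a \<in> set \<alpha>. 0 < a"
  shows "(\<forall>x \<le> sum_list \<alpha>. sum_list (take x (bounce_columns \<alpha>)) \<le> c + sum_list (take x ds)) \<longleftrightarrow>
    (\<forall>k < length \<alpha>. sum_list (take (Suc k) \<alpha>) \<le> c + sum_list (take (Suc (sum_list (take k \<alpha>))) ds))"
  using assms
proof (induction \<alpha> arbitrary: c ds)
  case Nil
  then show ?case by simp
next
  case (Cons a \<alpha>)
  have a: "0 < a" using Cons.prems by simp
  have L: "sum_list (take x (bounce_columns (a # \<alpha>))) =
      (if x = 0 then 0 else a + sum_list (take (x - a) (bounce_columns \<alpha>)))" for x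
    using a by (cases x) (simp_all add: sum_list_replicate_zero_append take_replicate sum_list_replicate)
  have R: "sum_list (take (a + x) ds) = sum_list (take a ds) + sum_list (take x (drop a ds))" for x
    by (simp add: take_add)
  show ?case (is "?lhs \<longleftrightarrow> ?rhs")
  proof
    assume l: ?lhs
    have 0: "a \<le> c + sum_list (take 1 ds)"
      using l[rule_format, of 1] a by (simp add: L)
    have "\<forall>x \<le> sum_list \<alpha>. sum_list (take x (bounce_columns \<alpha>)) \<le>
        (c + sum_list (take a ds) - a) + sum_list (take x (drop a ds))"
    proof (intro allI impI)
      fix x assume "x \<le> sum_list \<alpha>"
      then have "a + sum_list (take x (bounce_columns \<alpha>)) \<le> c + sum_list (take (a + x) ds)"
        using l[rule_format, of "a + x"] a by (simp only: L) simp
      then show "sum_list (take x (bounce_columns \<alpha>)) \<le>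
          (c + sum_list (take a ds) - a) + sum_list (take x (drop a ds))"
        unfolding R by linarith
    qed
    then have *: "\<forall>k < length \<alpha>. sum_list (take (Suc k) \<alpha>) \<le> (c + sum_list (take a ds) - a)
        + sum_list (take (Suc (sum_list (take k \<alpha>))) (drop a ds))"
      using Cons by simp
    have 1: "a \<le> c + sum_list (take a ds)"
      using 0 a sum_list_take_mono[of 1 a ds] by linarith
    show ?rhs
    proof (intro allI impI)
      fix k assume k: "k < length (a # \<alpha>)"
      show "sum_list (take (Suc k) (a # \<alpha>)) \<le> c + sum_list (take (Suc (sum_list (take k (a # \<alpha>)))) ds)"
      proof (cases k)
        case 0
        then show ?thesis using \<open>a \<le> c + sum_list (take 1 ds)\<close> by simp
      next
        case (Suc k')
        then show ?thesis
          using *[rule_format, of k'] k 1 R[of "Suc (sum_list (take k' \<alpha>))"] by simp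
      qed
    qed
  next
    assume r: ?rhs
    have 0: "a \<le> c + sum_list (take 1 ds)"
      using r[rule_format, of 0] by simp
    have 1: "a \<le> c + sum_list (take a ds)"
      using 0 a sum_list_take_mono[of 1 a ds] by linarith
    have "\<forall>k < length \<alpha>. sum_list (take (Suc k) \<alpha>) \<le> (c + sum_list (take a ds) - a)
        + sum_list (take (Suc (sum_list (take k \<alpha>))) (drop a ds))"
    proof (intro allI impI)
      fix k assume "k < length \<alpha>"
      then show "sum_list (take (Suc k) \<alpha>) \<le> (c + sum_list (take a ds) - a)
          + sum_list (take (Suc (sum_list (take k \<alpha>))) (drop a ds))"
        using r[rule_format, of "Suc k"] 1 R[of "Suc (sum_list (take k \<alpha>))"] by simp
    qed
    then have *: "\<forall>x \<le> sum_list \<alpha>. sum_list (take x (bounce_columns \<alpha>)) \<le>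
        (c + sum_list (take a ds) - a) + sum_list (take x (drop a ds))"
      using Cons by simp
    show ?lhs
    proof (intro allI impI)
      fix x assume x: "x \<le> sum_list (a # \<alpha>)"
      show "sum_list (take x (bounce_columns (a # \<alpha>))) \<le> c + sum_list (take x ds)"
      proof (cases "x \<le> a")
        case True
        then show ?thesis
          using 0 sum_list_take_mono[of 1 x ds] by (cases "x = 0") (simp_all only: L, simp_all)
      next
        case False
        then obtain m where m: "x = a + m" "x \<noteq> 0" "m \<le> sum_list \<alpha>"
          using x le_Suc_ex[of a x] by auto
        have "sum_list (take x (bounce_columns (a # \<alpha>))) = a + sum_list (take m (bounce_columns \<alpha>))"
          using L[of x] m by simp
        also have "\<dots> \<le> c + (sum_list (take a ds) + sum_list (take m (drop a ds)))"
          using *[rule_format, OF m(3)] 1 by linarith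
        finally show ?thesis
          unfolding m(1) R .
      qed
    qed
  qed
qed

lemma le_take_bounce_columns:
  assumes "\<forall>a \<in> set \<alpha>. 0 < a" "x \<le> sum_list \<alpha>"
  shows "x \<le> sum_list (take x (bounce_columns \<alpha>))"
  using assms
proof (induction \<alpha> arbitrary: x)
  case (Cons a \<alpha>)
  show ?case
  proof (cases x)
    case (Suc x')
    have "x - a \<le> sum_list (take (x - a) (bounce_columns \<alpha>))"
      using Cons.prems by (intro Cons.IH) auto
    then show ?thesis
      using Suc Cons.prems by (simp add: take_replicate sum_list_replicate)
  qed simp
qed simp

lemma bounce_path_dyck:
  assumes "\<forall>a \<in> set \<alpha>. 0 < a"
  shows "bounce_path \<alpha> \<in> dyck_paths (sum_list \<alpha>)"
  using assms le_take_bounce_columns[OF assms]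
  by (simp add: bounce_path_column_path column_path_dyck_iff)

lemma path_points_le: "(x, y) \<in> path_points p \<Longrightarrow> x \<le> count_list p E \<and> y \<le> count_list p N"
  by (auto simp: path_points_iff)

text \<open>The first block contributes only the origin; the contacts of the remaining path are
  shifted by \<open>a\<close>, which is positive and thus keeps them away from the origin.\<close>

lemma diagonal_contacts_bounce_path:
  assumes "\<forall>a \<in> set \<alpha>. 0 < a"
  shows "diagonal_contacts (bounce_path \<alpha>) = length \<alpha> + 1"
proof -
  define D where "D p = {x. (x, x) \<in> path_points p}" for p :: path
  have D: "diagonal_contacts p = card (D p)" for p
  proof -
    have "{(x, y) \<in> path_points p. x = y} = (\<lambda>x. (x, x)) ` D p"
      by (auto simp: D_def)
    then show ?thesis
      by (simp add: diagonal_contacts_def card_image inj_on_def)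
  qed
  have fin: "finite (D p)" for p
    using path_points_le[of _ _ p] finite_subset[of "D p" "{..count_list p E}"] by (auto simp: D_def)
  have "card (D (bounce_path \<alpha>)) = length \<alpha> + 1"
    using assms
  proof (induction \<alpha>)
    case Nil
    then show ?case by (simp add: D_def bounce_path_def)
  next
    case (Cons a \<alpha>)
    have "bounce_path (a # \<alpha>) = replicate a N @ replicate a E @ bounce_path \<alpha>"
      by (simp add: bounce_path_def)
    then have "D (bounce_path (a # \<alpha>)) = insert 0 ((+) a ` D (bounce_path \<alpha>))"
      using Cons.prems
      by (force simp: D_def path_points_replicate_N path_points_replicate_E)
    moreover have "0 \<notin> (+) a ` D (bounce_path \<alpha>)"
      using Cons.prems by auto
    ultimately show ?case
      using Cons fin by (simp add: card_image)
  qed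
  then show ?thesis by (simp add: D)
qed


section \<open>The coloring procedure on forests\<close>

primrec kids :: "ptree \<Rightarrow> ptree list" where
  "kids (Node ts) = ts"

fun subtree :: "ptree \<Rightarrow> node \<Rightarrow> ptree" where
  "subtree T [] = T"
| "subtree T (i # u) = subtree (kids T ! i) u"

fun is_node :: "ptree \<Rightarrow> node \<Rightarrow> bool" where
  "is_node T [] = True"
| "is_node T (i # u) = (i < length (kids T) \<and> is_node (kids T ! i) u)"

lemma subtree_append: "subtree T (u @ v) = subtree (subtree T u) v"
  by (induction T u rule: subtree.induct) auto

lemma is_node_append: "is_node T (u @ v) \<longleftrightarrow> is_node T u \<and> is_node (subtree T u) v"
  by (induction T u rule: subtree.induct) auto

text \<open>Indexing brings the \<open>map2\<close> of the definitions into a form to which the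
  induction hypothesis for \<open>ts ! i\<close> applies.\<close>

lemma map2_upt_map:
  "map2 f [0..<length ts] (map g ts) = map (\<lambda>i. f i (g (ts ! i))) [0..<length ts]"
  by (rule nth_equalityI) auto

lemma preorder_Node:
  "preorder (Node ts) = [] # concat (map (\<lambda>i. map ((#) i) (preorder (ts ! i))) [0..<length ts])"
  by (simp add: map2_upt_map)

declare preorder.simps [simp del]

lemma mem_preorder_iff: "u \<in> set (preorder T) \<longleftrightarrow> is_node T u"
proof (induction T arbitrary: u)
  case (Node ts)
  then show ?case
    by (cases u) (auto simp: preorder_Node image_iff)
qed

lemma nonroot_nodes_iff: "u \<in> nonroot_nodes T \<longleftrightarrow> u \<noteq> [] \<and> is_node T u"
  by (auto simp: nonroot_nodes_def mem_preorder_iff)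

lemma sorted_wrt_concat_map:
  assumes "\<And>x. x \<in> set xs \<Longrightarrow> sorted_wrt R (f x)"
    and "sorted_wrt (\<lambda>x y. \<forall>u \<in> set (f x). \<forall>v \<in> set (f y). R u v) xs"
  shows "sorted_wrt R (concat (map f xs))"
  using assms by (induction xs) (auto simp: sorted_wrt_append)

text \<open>LR-prefix order is thus the lexicographic order on addresses. Two enumerations of nodes
  then agree as soon as both are increasing and have the same elements, which is how the lists of
  nodes below are identified.\<close>

lemma sorted_preorder: "sorted_wrt (<) (preorder T)"
proof (induction T)
  case (Node ts)
  have "sorted_wrt (<) (concat (map (\<lambda>i. map ((#) i) (preorder (ts ! i))) [0..<length ts]))"
    by (rule sorted_wrt_concat_map)
      (use Node in \<open>auto simp: sorted_wrt_map intro: sorted_wrt_mono_rel[OF _ sorted_wrt_upt]\<close>)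
  then show ?case
    by (auto simp: preorder_Node)
qed

lemma distinct_preorder: "distinct (preorder T)"
  using sorted_preorder strict_sorted_iff by blast

lemma append_less_append_iff: "u @ x < u @ y \<longleftrightarrow> x < (y :: node)"
  by (induction u) auto

text \<open>The comparison is decided at the first entry where the addresses differ, so it passes on
  to all descendants.\<close>

lemma less_append_append: "u < v \<Longrightarrow> \<not> prefix u v \<Longrightarrow> u @ x < v @ (y :: node)"
proof (induction u arbitrary: v)
  case (Cons i u)
  then show ?case by (cases v) auto
qed simp

lemma mem_children_iff: "v \<in> set (children T u) \<longleftrightarrow> v \<noteq> [] \<and> butlast v = u \<and> is_node T v"
  by (auto simp: children_def mem_preorder_iff)

lemma sorted_children: "sorted_wrt (<) (children T u)"
  unfolding children_def by (rule sorted_wrt_filter) (rule sorted_preorder)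

lemma children_eq:
  assumes "is_node T u"
  shows "children T u = map (\<lambda>i. u @ [i]) [0..<length (kids (subtree T u))]"
proof (rule strict_sorted_equal)
  show "sorted_wrt (<) (children T u)"
    by (rule sorted_children)
  show "sorted_wrt (<) (map (\<lambda>i. u @ [i]) [0..<length (kids (subtree T u))])"
    by (simp add: sorted_wrt_map append_less_append_iff)
  have "v \<noteq> [] \<and> butlast v = u \<and> is_node T v \<longleftrightarrow>
      (\<exists>i < length (kids (subtree T u)). v = u @ [i])" for v
    using assms by (cases v rule: rev_cases) (auto simp: is_node_append)
  then have "set (children T u) = {v. \<exists>i < length (kids (subtree T u)). v = u @ [i]}"
    by (simp add: set_eq_iff mem_children_iff)
  then show "set (children T u) = set (map (\<lambda>i. u @ [i]) [0..<length (kids (subtree T u))])"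
    by auto
qed

lemma map_subtree_children:
  "is_node T u \<Longrightarrow> map (subtree T) (children T u) = kids (subtree T u)"
  by (simp add: children_eq o_def subtree_append map_nth)

section \<open>Active nodes and one step of the coloring procedure\<close>

lemma mem_active_iff:
  "u \<in> set (active T C) \<longleftrightarrow>
     u \<noteq> [] \<and> is_node T u \<and> u \<notin> C \<and> (butlast u = [] \<or> butlast u \<in> C)"
  by (auto simp: active_def mem_preorder_iff)

lemma sorted_active: "sorted_wrt (<) (active T C)"
  unfolding active_def by (rule sorted_wrt_filter) (rule sorted_preorder)

definition ancestor_closed :: "ptree \<Rightarrow> node set \<Rightarrow> bool" where
  "ancestor_closed T C \<longleftrightarrow> C \<subseteq> nonroot_nodes T \<and> (\<forall>u \<in> C. butlast u = [] \<or> butlast u \<in> C)"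

lemma ancestor_closed_prefix:
  assumes "ancestor_closed T C" "v \<in> C" "prefix u v" "u \<noteq> []"
  shows "u \<in> C"
  using assms(2,3)
proof (induction v rule: rev_induct)
  case (snoc i v)
  then show ?case
    using assms(1,4) unfolding ancestor_closed_def by (auto simp: prefix_snoc)
qed (use assms in \<open>auto simp: ancestor_closed_def nonroot_nodes_def\<close>)

text \<open>If \<open>u\<close> were a proper ancestor of \<open>v\<close>, it would be an ancestor
  of the parent of \<open>v\<close> or that parent itself. The parent would be colored, and by
  closure so would \<open>u\<close>.\<close>

lemma active_antichain:
  assumes C: "ancestor_closed T C" and u: "u \<in> set (active T C)" and v: "v \<in> set (active T C)"
    and "prefix u v"
  shows "u = v"
proof (rule ccontr)
  assume "u \<noteq> v"
  moreover have "v \<noteq> []" using v by (simp add: mem_active_iff)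
  ultimately have p: "prefix u (butlast v)"
    using \<open>prefix u v\<close> by (metis append_butlast_last_id prefix_snoc)
  have "u \<noteq> []" "u \<notin> C" using u by (auto simp: mem_active_iff)
  moreover have "butlast v \<in> C"
    using v p \<open>u \<noteq> []\<close> by (auto simp: mem_active_iff)
  ultimately show False
    using ancestor_closed_prefix[OF C _ p] by blast
qed

lemma ancestor_closed_step:
  assumes "ancestor_closed T C" "D \<subseteq> set (active T C)"
  shows "ancestor_closed T (C \<union> D)"
  using assms unfolding ancestor_closed_def
  by (auto simp: mem_active_iff nonroot_nodes_iff subset_iff)

text \<open>Since the active nodes form an antichain, every descendant of an earlier one precedes
  every descendant of a later one. Putting the children in the place of their parent hence keeps
  LR-prefix order.\<close>

lemma active_step:
  assumes C: "ancestor_closed T C"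
  defines "A \<equiv> active T C"
  shows "active T (C \<union> set (take a A)) = concat (map (children T) (take a A)) @ drop a A"
proof (rule strict_sorted_equal)
  let ?D = "set (take a A)"
  have A: "A = take a A @ drop a A" by simp
  have sA: "sorted_wrt (<) (take a A)" "sorted_wrt (<) (drop a A)"
      "\<forall>u \<in> ?D. \<forall>v \<in> set (drop a A). u < v"
    using sorted_active[of T C] A unfolding A_def by (metis sorted_wrt_append)+
  have D: "?D \<subseteq> set A" "set (drop a A) \<subseteq> set A"
    by (auto dest: in_set_takeD in_set_dropD)
  have less: "u @ x < v @ y" if "u \<in> set A" "v \<in> set A" "u < v" for u v x y
    using that active_antichain[OF C] less_append_append unfolding A_def by blast
  have child: "\<exists>i. v = u @ [i]" if "v \<in> set (children T u)" for u v
    using that by (metis mem_children_iff append_butlast_last_id)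
  show "sorted_wrt (<) (active T (C \<union> ?D))"
    by (rule sorted_active)
  show "sorted_wrt (<) (concat (map (children T) (take a A)) @ drop a A)"
    unfolding sorted_wrt_append
  proof (intro conjI ballI)
    show "sorted_wrt (<) (concat (map (children T) (take a A)))"
    proof (rule sorted_wrt_concat_map)
      show "sorted_wrt (\<lambda>x y. \<forall>u \<in> set (children T x). \<forall>v \<in> set (children T y). u < v) (take a A)"
      proof (rule sorted_wrt_mono_rel[OF _ sA(1)])
        fix x y assume "x \<in> ?D" "y \<in> ?D" "x < y"
        then have "x @ p < y @ q" for p q
          using less D by blast
        then show "\<forall>u \<in> set (children T x). \<forall>v \<in> set (children T y). u < v"
          using child by blast
      qed
    qed (rule sorted_children)
    fix u v assume "u \<in> set (concat (map (children T) (take a A)))" and v: "v \<in> set (drop a A)"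
    then obtain w where w: "w \<in> ?D" "u \<in> set (children T w)" by auto
    then obtain i where "u = w @ [i]" using child by blast
    moreover have "w @ [i] < v @ []"
      using w v sA(3) D by (intro less) auto
    ultimately show "u < v" by simp
  qed (rule sA(2))
  have dA: "distinct A" unfolding A_def using sorted_active strict_sorted_iff by blast
  have "set A = ?D \<union> set (drop a A)" by (metis A set_append)
  moreover have "?D \<inter> set (drop a A) = {}" using dA by (metis A distinct_append)
  ultimately have dis: "set (drop a A) = set A - ?D" by blast
  have "u \<in> set (active T (C \<union> ?D)) \<longleftrightarrow>
      u \<in> set (drop a A) \<or> (\<exists>w \<in> ?D. u \<in> set (children T w))" for u
  proof
    assume "u \<in> set (active T (C \<union> ?D))"
    then show "u \<in> set (drop a A) \<or> (\<exists>w \<in> ?D. u \<in> set (children T w))"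
      unfolding dis mem_children_iff by (auto simp: A_def mem_active_iff)
  next
    assume "u \<in> set (drop a A) \<or> (\<exists>w \<in> ?D. u \<in> set (children T w))"
    then show "u \<in> set (active T (C \<union> ?D))"
    proof
      assume "u \<in> set (drop a A)"
      then show ?thesis
        unfolding dis by (auto simp: A_def mem_active_iff)
    next
      assume "\<exists>w \<in> ?D. u \<in> set (children T w)"
      then obtain w where w: "w \<in> ?D" "u \<noteq> []" "butlast u = w" "is_node T u"
        by (auto simp: mem_children_iff)
      then have "w \<in> set A" using D by auto
      then have "w \<noteq> []" "w \<notin> C" by (auto simp: A_def mem_active_iff)
      then have "u \<notin> C" using w C by (auto simp: ancestor_closed_def)
      moreover have "u \<notin> ?D"
        using w D \<open>w \<noteq> []\<close> \<open>w \<notin> C\<close> by (auto simp: A_def mem_active_iff)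
      ultimately show ?thesis
        using w by (simp add: mem_active_iff)
    qed
  qed
  then show "set (active T (C \<union> ?D)) = set (concat (map (children T) (take a A)) @ drop a A)"
    by auto
qed

lemma ancestor_closed_colored: "ancestor_closed T (colored T \<alpha> k)"
proof (induction k)
  case 0
  then show ?case by (simp add: ancestor_closed_def)
next
  case (Suc k)
  then show ?case by (auto intro!: ancestor_closed_step dest: in_set_takeD)
qed

lemma sorted_active_after: "sorted_wrt (<) (active_after T \<alpha> k)"
  by (simp add: active_after_def sorted_active)

lemma distinct_active_after: "distinct (active_after T \<alpha> k)"
  using sorted_active_after strict_sorted_iff by blast

lemma active_after_nonroot: "u \<in> set (active_after T \<alpha> k) \<Longrightarrow> u \<noteq> [] \<and> is_node T u"
  by (auto simp: active_after_def mem_active_iff)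

lemma active_after_0: "active_after T \<alpha> 0 = children T []"
  unfolding active_after_def active_def children_def by (auto intro: filter_cong)

lemma active_after_Suc:
  "active_after T \<alpha> (Suc k) =
     concat (map (children T) (take (\<alpha> ! k) (active_after T \<alpha> k))) @ drop (\<alpha> ! k) (active_after T \<alpha> k)"
  unfolding active_after_def by (simp add: active_step[OF ancestor_closed_colored])

text \<open>
  One step of the coloring procedure, seen on the list of the subtrees hanging from the active
  nodes: this list carries all the information needed for the later steps.
\<close>

definition forest_step :: "nat \<Rightarrow> ptree list \<Rightarrow> ptree list" where
  "forest_step a F = concat (map kids (take a F)) @ drop a F"

definition active_forest :: "ptree \<Rightarrow> nat list \<Rightarrow> nat \<Rightarrow> ptree list" where
  "active_forest T \<alpha> k = map (subtree T) (active_after T \<alpha> k)"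

lemma length_active_forest [simp]: "length (active_forest T \<alpha> k) = length (active_after T \<alpha> k)"
  by (simp add: active_forest_def)

lemma active_forest_0: "active_forest T \<alpha> 0 = kids T"
  by (simp add: active_forest_def active_after_0 map_subtree_children)

lemma active_forest_Suc: "active_forest T \<alpha> (Suc k) = forest_step (\<alpha> ! k) (active_forest T \<alpha> k)"
proof -
  have "map (map (subtree T) \<circ> children T) (take (\<alpha> ! k) (active_after T \<alpha> k)) =
      map (kids \<circ> subtree T) (take (\<alpha> ! k) (active_after T \<alpha> k))"
    by (auto dest!: in_set_takeD active_after_nonroot simp: map_subtree_children)
  then show ?thesis
    unfolding active_forest_def active_after_Suc forest_step_def
    by (simp only: map_append map_concat take_map drop_map map_map)
qed

text \<open>Positivity of the parts and exhaustion of the tree are built in: up to the value of the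
  sum, this one recursive predicate replaces both \<open>compositions\<close> and
  \<open>alpha_tree\<close>.\<close>

fun colorable :: "ptree list \<Rightarrow> nat list \<Rightarrow> bool" where
  "colorable F [] = (F = [])"
| "colorable F (a # \<alpha>) = (0 < a \<and> a \<le> length F \<and> colorable (forest_step a F) \<alpha>)"

definition forest_size :: "ptree list \<Rightarrow> nat" where
  "forest_size F = sum_list (map (length \<circ> preorder) F)"

lemma length_preorder: "length (preorder T) = Suc (forest_size (kids T))"
proof (cases T)
  case (Node ts)
  have "map (\<lambda>i. length (preorder (ts ! i))) [0..<length ts] = map (length \<circ> preorder) ts"
    by (rule nth_equalityI) auto
  then show ?thesis
    by (simp add: Node preorder_Node length_concat o_def forest_size_def)
qed

lemma card_nonroot_nodes: "card (nonroot_nodes T) = forest_size (kids T)"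
  using distinct_preorder[of T] mem_preorder_iff[of "[]" T] length_preorder[of T]
  by (simp add: nonroot_nodes_def distinct_card)

lemma forest_size_eq_0: "forest_size F = 0 \<longleftrightarrow> F = []"
  by (cases F) (auto simp: forest_size_def length_preorder)

lemma forest_size_append: "forest_size (F @ G) = forest_size F + forest_size G"
  by (simp add: forest_size_def)

lemma forest_size_kids: "forest_size (concat (map kids F)) + length F = forest_size F"
  by (induction F) (auto simp: forest_size_def length_preorder)

lemma forest_size_step:
  assumes "a \<le> length F"
  shows "forest_size (forest_step a F) + a = forest_size F"
  using assms forest_size_kids[of "take a F"] forest_size_append[of "take a F" "drop a F"]
  by (simp add: forest_step_def forest_size_append)

text \<open>Each step removes exactly as many nodes as its part says, so the final condition
  \<open>F = []\<close> of \<open>colorable\<close> amounts to the node count demanded by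
  \<open>alpha_tree\<close>.\<close>

lemma colorable_active_forest_iff:
  assumes "j \<le> length \<alpha>"
  shows "colorable (active_forest T \<alpha> j) (drop j \<alpha>) \<longleftrightarrow>
    (\<forall>a \<in> set (drop j \<alpha>). 0 < a) \<and>
    (\<forall>k. j \<le> k \<and> k < length \<alpha> \<longrightarrow> \<alpha> ! k \<le> length (active_after T \<alpha> k)) \<and>
    forest_size (active_forest T \<alpha> j) = sum_list (drop j \<alpha>)"
  using assms
proof (induction j rule: inc_induct)
  case base
  then show ?case by (simp add: forest_size_eq_0)
next
  case (step j)
  then have d: "drop j \<alpha> = \<alpha> ! j # drop (Suc j) \<alpha>"
    by (metis Cons_nth_drop_Suc)
  have all: "(\<forall>k. j \<le> k \<and> k < length \<alpha> \<longrightarrow> P k) \<longleftrightarrow> P j \<and> (\<forall>k. Suc j \<le> k \<and> k < length \<alpha> \<longrightarrow> P k)" for P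
    using step by (metis Suc_leD Suc_leI le_neq_implies_less order_refl)
  show ?case
    using step.IH forest_size_step[of "\<alpha> ! j" "active_forest T \<alpha> j"]
    unfolding all d by (auto simp: active_forest_Suc)
qed

lemma LAC_iff: "(T, \<alpha>) \<in> LAC n \<longleftrightarrow> colorable (kids T) \<alpha> \<and> sum_list \<alpha> = n"
  using colorable_active_forest_iff[of 0 \<alpha> T]
  by (auto simp: LAC_def compositions_def alpha_tree_def active_forest_0 card_nonroot_nodes)

lemma colorable_positive: "colorable F \<alpha> \<Longrightarrow> \<forall>a \<in> set \<alpha>. 0 < a"
  by (induction F \<alpha> rule: colorable.induct) auto

section \<open>Colors in a LAC tree\<close>

lemma LAC_colorable:
  assumes "(T, \<alpha>) \<in> LAC n" "k \<le> length \<alpha>"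
  shows "colorable (active_forest T \<alpha> k) (drop k \<alpha>)"
  using assms(2)
proof (induction k)
  case 0
  then show ?case using assms(1) by (simp add: LAC_iff active_forest_0)
next
  case (Suc k)
  then have "drop k \<alpha> = \<alpha> ! k # drop (Suc k) \<alpha>"
    by (metis Cons_nth_drop_Suc Suc_le_lessD)
  then show ?case using Suc by (simp add: active_forest_Suc)
qed

lemma LAC_active_after_length: "(T, \<alpha>) \<in> LAC n \<Longrightarrow> k < length \<alpha> \<Longrightarrow> \<alpha> ! k \<le> length (active_after T \<alpha> k)"
  by (simp add: LAC_def alpha_tree_def)

text \<open>No node is active at the end, whereas an uncolored non-root node of least depth would
  be.\<close>

lemma LAC_colored_all:
  assumes "(T, \<alpha>) \<in> LAC n"
  shows "colored T \<alpha> (length \<alpha>) = nonroot_nodes T"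
proof
  show "colored T \<alpha> (length \<alpha>) \<subseteq> nonroot_nodes T"
    using ancestor_closed_colored by (auto simp: ancestor_closed_def)
  have empty: "active T (colored T \<alpha> (length \<alpha>)) = []"
    using LAC_colorable[OF assms, of "length \<alpha>"] by (simp add: active_forest_def active_after_def)
  have "u \<noteq> [] \<longrightarrow> is_node T u \<longrightarrow> u \<in> colored T \<alpha> (length \<alpha>)" for u
  proof (induction u rule: rev_induct)
    case (snoc i u)
    then have "u @ [i] \<notin> set (active T (colored T \<alpha> (length \<alpha>)))"
      using empty by simp
    then show ?case
      using snoc unfolding mem_active_iff by (auto simp: is_node_append)
  qed simp
  then show "nonroot_nodes T \<subseteq> colored T \<alpha> (length \<alpha>)"
    by (auto simp: nonroot_nodes_iff)
qed

lemma colored_mono: "j \<le> k \<Longrightarrow> colored T \<alpha> j \<subseteq> colored T \<alpha> k"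
  by (induction k rule: dec_induct) auto

text \<open>The assumption gives the \<open>LEAST\<close> in \<open>color\<close> a meaning: the
  root and nodes that never get colored have no specified color.\<close>

lemma color_eq_Suc_iff:
  assumes "u \<in> colored T \<alpha> m"
  shows "color T \<alpha> u = Suc k \<longleftrightarrow> u \<in> set (take (\<alpha> ! k) (active_after T \<alpha> k))"
proof -
  have "color T \<alpha> u = Suc k \<longleftrightarrow> u \<in> colored T \<alpha> (Suc k) \<and> u \<notin> colored T \<alpha> k"
  proof
    assume c: "color T \<alpha> u = Suc k"
    then show "u \<in> colored T \<alpha> (Suc k) \<and> u \<notin> colored T \<alpha> k"
      using assms unfolding color_def by (metis LeastI lessI not_less_Least)
  next
    assume *: "u \<in> colored T \<alpha> (Suc k) \<and> u \<notin> colored T \<alpha> k"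
    show "color T \<alpha> u = Suc k"
      unfolding color_def
    proof (rule Least_equality)
      show "u \<in> colored T \<alpha> (Suc k)" using * by blast
      fix j assume "u \<in> colored T \<alpha> j"
      then show "Suc k \<le> j"
        using * colored_mono[of j k T \<alpha>] by (meson not_less_eq_eq subsetD)
    qed
  qed
  also have "\<dots> \<longleftrightarrow> u \<in> set (take (\<alpha> ! k) (active_after T \<alpha> k))"
    by (auto simp: active_after_def mem_active_iff dest: in_set_takeD)
  finally show ?thesis .
qed

lemma LAC_color_cases:
  assumes "(T, \<alpha>) \<in> LAC n" "u \<noteq> []" "is_node T u"
  obtains k where "k < length \<alpha>" "color T \<alpha> u = Suc k"
proof -
  have u: "u \<in> colored T \<alpha> (length \<alpha>)"
    using LAC_colored_all[OF assms(1)] assms(2,3) by (simp add: nonroot_nodes_iff)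
  then have "color T \<alpha> u \<le> length \<alpha>"
    unfolding color_def by (rule Least_le)
  moreover have "u \<in> colored T \<alpha> (color T \<alpha> u)"
    unfolding color_def using u by (rule LeastI)
  ultimately show ?thesis
    using that by (cases "color T \<alpha> u") auto
qed

lemma LAC_color_eq_iff:
  assumes "(T, \<alpha>) \<in> LAC n" "u \<noteq> []" "is_node T u"
  shows "color T \<alpha> u = Suc k \<longleftrightarrow> u \<in> set (take (\<alpha> ! k) (active_after T \<alpha> k))"
  using LAC_colored_all[OF assms(1)] assms(2,3) by (metis color_eq_Suc_iff nonroot_nodes_iff)

lemma LAC_color_class:
  assumes "(T, \<alpha>) \<in> LAC n"
  shows "color_class T \<alpha> (Suc k) = take (\<alpha> ! k) (active_after T \<alpha> k)"
proof (rule strict_sorted_equal)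
  show "sorted_wrt (<) (color_class T \<alpha> (Suc k))"
    unfolding color_class_def by (rule sorted_wrt_filter) (rule sorted_preorder)
  show "sorted_wrt (<) (take (\<alpha> ! k) (active_after T \<alpha> k))"
    using sorted_active_after by (rule sorted_wrt_take)
  show "set (color_class T \<alpha> (Suc k)) = set (take (\<alpha> ! k) (active_after T \<alpha> k))"
    using LAC_color_eq_iff[OF assms, of _ k]
      active_after_nonroot[OF in_set_takeD, of _ _ T \<alpha> k]
    by (auto simp: color_class_def mem_preorder_iff)
qed


section \<open>Pairs with bounce bottom path\<close>

abbreviation degree :: "ptree \<Rightarrow> nat" where
  "degree t \<equiv> length (kids t)"

text \<open>
  The degrees of the non-root nodes, listed by increasing color and from right to left within
  each color. Prefixed with the degree of the root, they are the numbers of north-steps preceding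
  the east-steps of \<open>tree_path\<close>, followed by a final \<open>0\<close>.
\<close>

fun degree_word :: "ptree list \<Rightarrow> nat list \<Rightarrow> nat list" where
  "degree_word F [] = []"
| "degree_word F (a # \<alpha>) = rev (map degree (take a F)) @ degree_word (forest_step a F) \<alpha>"

text \<open>The pairs \<open>(\<alpha>, es)\<close> for which the procedure, started with \<open>l\<close> active nodes, can be run.\<close>

fun feasible :: "nat \<Rightarrow> nat list \<Rightarrow> nat list \<Rightarrow> bool" where
  "feasible l [] es = (l = 0 \<and> es = [])"
| "feasible l (a # \<alpha>) es =
     (0 < a \<and> a \<le> l \<and> a \<le> length es \<and> feasible (l - a + sum_list (take a es)) \<alpha> (drop a es))"

lemma length_forest_step: "length (forest_step a F) = sum_list (map degree (take a F)) + (length F - a)"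
  by (simp add: forest_step_def length_concat o_def)

lemma feasible_degree_word: "colorable F \<alpha> \<Longrightarrow> feasible (length F) \<alpha> (degree_word F \<alpha>)"
  by (induction F \<alpha> rule: colorable.induct) (simp_all add: length_forest_step add.commute)

text \<open>The step is undone: the forests after it agree by induction, and the common degrees cut
  their common initial part into the same lists of children.\<close>

lemma degree_word_inject:
  assumes "colorable F \<alpha>" "colorable G \<alpha>" "length F = length G" "degree_word F \<alpha> = degree_word G \<alpha>"
  shows "F = G"
  using assms
proof (induction \<alpha> arbitrary: F G)
  case (Cons a \<alpha>)
  have deg: "map degree (take a F) = map degree (take a G)"
    and dw: "degree_word (forest_step a F) \<alpha> = degree_word (forest_step a G) \<alpha>"
    using Cons.prems by simp_all
  have "forest_step a F = forest_step a G"
    using Cons.prems deg by (intro Cons.IH dw) (simp_all add: length_forest_step)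
  moreover have "length (concat (map kids (take a F))) = length (concat (map kids (take a G)))"
    using deg by (simp add: length_concat o_def)
  ultimately have concat: "concat (map kids (take a F)) = concat (map kids (take a G))"
    and drop: "drop a F = drop a G"
    by (simp_all add: forest_step_def)
  have "map kids (take a F) = map kids (take a G)"
  proof (rule concat_injective[OF concat])
    show "length (map kids (take a F)) = length (map kids (take a G))"
      using Cons.prems by simp
    have "length (map kids (take a F) ! i) = length (map kids (take a G) ! i)"
      if "i < length (take a F)" for i
      using that arg_cong[OF deg, of "\<lambda>xs. xs ! i"] Cons.prems by simp
    then show "\<forall>(x, y) \<in> set (zip (map kids (take a F)) (map kids (take a G))). length x = length y"
      by (auto simp: set_zip)
  qed
  moreover have "inj kids"
    by (rule injI) (metis kids.simps ptree.exhaust)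
  ultimately have "take a F = take a G"
    by (simp add: inj_map_eq_map)
  then show ?case
    using drop by (metis append_take_drop_id)
qed simp

lemma ex_split_by_lengths:
  "sum_list ds \<le> length F \<Longrightarrow> \<exists>xss. map length xss = ds \<and> concat xss @ drop (sum_list ds) F = F"
proof (induction ds arbitrary: F)
  case (Cons d ds)
  have "sum_list ds \<le> length (drop d F)"
    using Cons.prems by simp
  from Cons.IH[OF this] obtain xss
    where "map length xss = ds" "concat xss @ drop (sum_list ds) (drop d F) = drop d F"
    by blast
  then show ?case
    using Cons.prems by (intro exI[of _ "take d F # xss"]) (simp add: add.commute)
qed simp

lemma ex_forest_degree_word:
  "feasible l \<alpha> es \<Longrightarrow> \<exists>F. length F = l \<and> colorable F \<alpha> \<and> degree_word F \<alpha> = es"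
proof (induction l \<alpha> es rule: feasible.induct)
  case (2 l a \<alpha> es)
  then obtain F' where F': "length F' = l - a + sum_list (take a es)" "colorable F' \<alpha>"
      "degree_word F' \<alpha> = drop a es"
    by auto
  \<comment> \<open>Consecutive blocks of \<open>F'\<close> become the children of the first
    \<open>a\<close> trees; the degree word lists these trees from right to left, hence the
    reversal.\<close>
  obtain xss where xss: "map length xss = rev (take a es)"
      "concat xss @ drop (sum_list (rev (take a es))) F' = F'"
    using ex_split_by_lengths[of "rev (take a es)" F'] F' by auto
  define F where "F = map Node xss @ drop (sum_list (rev (take a es))) F'"
  have len: "length xss = a"
    using arg_cong[OF xss(1), of length] 2 by simp
  have "forest_step a F = F'"
    using len xss(2) by (simp add: F_def forest_step_def o_def)
  moreover have "map degree (take a F) = rev (take a es)"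
    using len xss(1) by (simp add: F_def o_def)
  moreover have "length F = l"
    using len F' 2 by (simp add: F_def)
  ultimately show ?case
    using F' 2 by (intro exI[of _ F]) (simp add: rev_swap)
qed simp

text \<open>The recursion unrolled: before step \<open>k + 1\<close> the number of active nodes is
  \<open>l\<close>, plus the degrees read so far, minus the
  \<open>sum_list (take k \<alpha>)\<close> nodes already colored.\<close>

lemma feasible_iff:
  "feasible l \<alpha> es \<longleftrightarrow> (\<forall>a \<in> set \<alpha>. 0 < a) \<and> length es = sum_list \<alpha> \<and> l + sum_list es = sum_list \<alpha> \<and>
     (\<forall>k < length \<alpha>. sum_list (take (Suc k) \<alpha>) \<le> l + sum_list (take (sum_list (take k \<alpha>)) es))"
proof (induction l \<alpha> es rule: feasible.induct)
  case (1 l es)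
  then show ?case by auto
next
  case (2 l a \<alpha> es)
  have all: "(\<forall>k < Suc m. P k) \<longleftrightarrow> P 0 \<and> (\<forall>k < m. P (Suc k))" for P m
    by (metis less_Suc_eq_0_disj)
  have split: "sum_list (take (a + m) es) = sum_list (take a es) + sum_list (take m (drop a es))" for m
    by (simp add: take_add)
  have total: "sum_list es = sum_list (take a es) + sum_list (drop a es)"
    by (metis append_take_drop_id sum_list.append)
  show ?case
  proof (cases "0 < a \<and> a \<le> l \<and> a \<le> length es")
    case True
    let ?l = "l - a + sum_list (take a es)"
    have "length (drop a es) = sum_list \<alpha> \<longleftrightarrow> length es = a + sum_list \<alpha>"
      using True by auto
    moreover have "?l + sum_list (drop a es) = sum_list \<alpha> \<longleftrightarrow> l + sum_list es = a + sum_list \<alpha>"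
      using True total by linarith
    moreover have "x \<le> ?l + sum_list (take m (drop a es)) \<longleftrightarrow> a + x \<le> l + sum_list (take (a + m) es)" for x m
      using True split[of m] by linarith
    ultimately show ?thesis
      using True 2 by (simp add: all)
  next
    case False
    then show ?thesis by (auto simp: all)
  qed
qed

text \<open>The nodes of the last color are leaves, because a child of one of them would never be
  colored.\<close>

lemma feasible_last: "feasible l \<alpha> es \<Longrightarrow> \<alpha> \<noteq> [] \<Longrightarrow> es \<noteq> [] \<and> last es = 0"
proof (induction l \<alpha> es rule: feasible.induct)
  case (2 l a \<alpha> es)
  show ?case
  proof (cases "\<alpha> = []")
    case True
    then have "es \<noteq> []" "\<forall>e \<in> set es. e = 0" using 2 by auto
    then show ?thesis by simp
  next
    case False
    have "feasible (l - a + sum_list (take a es)) \<alpha> (drop a es)"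
      using 2(2) unfolding feasible.simps by blast
    then have *: "drop a es \<noteq> []" "last (drop a es) = 0"
      using 2(1) False by blast+
    then have "a < length es" by simp
    then show ?thesis using * by (metis last_drop drop_Nil)
  qed
qed simp

text \<open>The head of \<open>ds\<close> plays the degree of the root, and the appended
  \<open>0\<close> is the degree of the node listed last, which has no column of its own. At the
  first column of a block the height of the upper path is the number of nodes colored or active
  before that step, so nestedness there says that the step does not fail. A path above a bounce path
  is automatically a Dyck path.\<close>

lemma BP_column_path_iff:
  assumes \<alpha>: "\<forall>a \<in> set \<alpha>. 0 < a" and ds: "length ds = sum_list \<alpha>" "ds \<noteq> []"
  shows "(bounce_path \<alpha>, column_path ds) \<in> BP (sum_list \<alpha>) \<longleftrightarrow> feasible (hd ds) \<alpha> (tl ds @ [0])"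
proof -
  have tl: "hd ds + sum_list (take m (tl ds @ [0])) = sum_list (take (Suc m) ds)" for m
    using ds(2) by (cases ds; cases "m - length (tl ds)") (simp_all add: take_Cons)
  have total: "hd ds + sum_list (tl ds @ [0]) = sum_list ds"
    using ds(2) by (cases ds) simp_all
  have len: "length (tl ds @ [0]) = sum_list \<alpha>"
    using ds by (cases ds) simp_all
  have "feasible (hd ds) \<alpha> (tl ds @ [0]) \<longleftrightarrow> sum_list ds = sum_list \<alpha> \<and>
      (\<forall>k < length \<alpha>. sum_list (take (Suc k) \<alpha>) \<le> sum_list (take (Suc (sum_list (take k \<alpha>))) ds))"
    unfolding feasible_iff tl total len using \<alpha> by simp
  also have "\<dots> \<longleftrightarrow> sum_list ds = sum_list \<alpha> \<and>
      (\<forall>x \<le> sum_list \<alpha>. sum_list (take x (bounce_columns \<alpha>)) \<le> sum_list (take x ds))"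
    using take_bounce_columns_le_iff[OF \<alpha>, of 0 ds] by simp
  also have "\<dots> \<longleftrightarrow> column_path ds \<in> dyck_paths (sum_list \<alpha>) \<and> nested (bounce_path \<alpha>) (column_path ds)"
  proof (cases "sum_list ds = sum_list \<alpha>")
    case True
    have "nested (bounce_path \<alpha>) (column_path ds) \<longleftrightarrow>
      (\<forall>x \<le> sum_list \<alpha>. sum_list (take x (bounce_columns \<alpha>)) \<le> sum_list (take x ds))"
      using nested_column_path_iff[of "bounce_columns \<alpha>" ds] \<alpha> ds True
      by (simp add: bounce_path_column_path)
    moreover have "x \<le> sum_list (take x ds)"
      if "\<forall>x \<le> sum_list \<alpha>. sum_list (take x (bounce_columns \<alpha>)) \<le> sum_list (take x ds)" "x \<le> sum_list \<alpha>" for x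
      using that le_take_bounce_columns[OF \<alpha>] le_trans by blast
    ultimately show ?thesis
      using ds True by (auto simp: column_path_dyck_iff)
  next
    case False
    then show ?thesis by (simp add: column_path_dyck_iff)
  qed
  also have "\<dots> \<longleftrightarrow> (bounce_path \<alpha>, column_path ds) \<in> BP (sum_list \<alpha>)"
    using \<alpha> bounce_path_dyck[OF \<alpha>] by (auto simp: BP_def nested_pairs_def bounce_def)
  finally show ?thesis by simp
qed

text \<open>The colored and active nodes are exactly the children of the root and of the colored
  nodes; the last equation counts them in both ways.\<close>

lemma degree_word_split:
  assumes "(T, \<alpha>) \<in> LAC n" "k \<le> length \<alpha>"
  shows "\<exists>pre. degree_word (kids T) \<alpha> = pre @ degree_word (active_forest T \<alpha> k) (drop k \<alpha>) \<and>
    length pre = sum_list (take k \<alpha>) \<and>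
    degree T + sum_list pre = sum_list (take k \<alpha>) + length (active_after T \<alpha> k)"
  using assms(2)
proof (induction k)
  case 0
  then show ?case
    using length_active_forest[of T \<alpha> 0] by (simp add: active_forest_0)
next
  case (Suc k)
  then obtain pre where pre:
    "degree_word (kids T) \<alpha> = pre @ degree_word (active_forest T \<alpha> k) (drop k \<alpha>)"
    "length pre = sum_list (take k \<alpha>)"
    "degree T + sum_list pre = sum_list (take k \<alpha>) + length (active_after T \<alpha> k)"
    by auto
  have d: "drop k \<alpha> = \<alpha> ! k # drop (Suc k) \<alpha>"
    using Suc.prems by (metis Cons_nth_drop_Suc Suc_le_lessD)
  have le: "\<alpha> ! k \<le> length (active_after T \<alpha> k)"
    using LAC_active_after_length[OF assms(1)] Suc.prems by simp
  have "length (active_after T \<alpha> (Suc k)) =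
      sum_list (map degree (take (\<alpha> ! k) (active_forest T \<alpha> k))) + (length (active_after T \<alpha> k) - \<alpha> ! k)"
    using length_active_forest[of T \<alpha> "Suc k"] by (simp add: active_forest_Suc length_forest_step)
  then show ?case
    using pre d le Suc.prems
    by (intro exI[of _ "pre @ rev (map degree (take (\<alpha> ! k) (active_forest T \<alpha> k)))"])
      (simp add: active_forest_Suc sum_list_take_Suc)
qed

section \<open>Marked points as valleys of the path given by the degrees\<close>

lemma children_eq_Nil_iff: "is_node T u \<Longrightarrow> children T u = [] \<longleftrightarrow> degree (subtree T u) = 0"
  by (simp add: children_eq)

text \<open>Here \<open>k\<close> is 0-based and \<open>i\<close> is 1-based, so \<open>u\<close>
  has color \<open>k + 1\<close>. The \<open>s + length A\<close> colored or active nodes are the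
  children of the root and of the colored nodes. Removing the \<open>j\<close> children of the first
  \<open>i\<close> nodes of the class leaves the children of the root, of nodes of earlier colors
  and of the nodes to the right of \<open>u\<close> in its class; the degrees of the last two kinds
  fill the first \<open>s - i\<close> places of \<open>es\<close>.\<close>

lemma marked_point_of_node:
  assumes LAC: "(T, \<alpha>) \<in> LAC n" and k: "k < length \<alpha>" and i: "0 < i" "i \<le> \<alpha> ! k"
  defines "u \<equiv> active_after T \<alpha> k ! (i - 1)"
    and "es \<equiv> degree_word (kids T) \<alpha>"
    and "s \<equiv> sum_list (take (Suc k) \<alpha>)"
    and "A \<equiv> active_after T \<alpha> (Suc k)"
  shows "es ! (s - i) = degree (subtree T u)"
    and "0 < degree (subtree T u) \<Longrightarrow>
      \<exists>j \<in> {1..length A}. A ! (j - 1) = last (children T u) \<and>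
        s + length A - j = degree T + sum_list (take (s - i) es)"
proof -
  let ?B = "active_after T \<alpha> k"
  define a where "a = \<alpha> ! k"
  define cls where "cls = take a ?B"
  define ds where "ds = map (\<lambda>v. length (children T v)) cls"
  obtain pre where pre: "es = pre @ degree_word (active_forest T \<alpha> k) (drop k \<alpha>)"
    "length pre = sum_list (take k \<alpha>)" "degree T + sum_list pre = sum_list (take k \<alpha>) + length ?B"
    using degree_word_split[OF LAC, of k] k unfolding es_def by auto
  have d: "drop k \<alpha> = a # drop (Suc k) \<alpha>"
    using k unfolding a_def by (metis Cons_nth_drop_Suc)
  have a: "a \<le> length ?B"
    using LAC_active_after_length[OF LAC k] by (simp add: a_def)
  have deg: "length (children T v) = degree (subtree T v)" if "v \<in> set ?B" for v
    using that by (simp add: children_eq active_after_nonroot)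
  have "map degree (take a (active_forest T \<alpha> k)) = ds"
    by (auto simp: active_forest_def take_map ds_def cls_def deg dest: in_set_takeD)
  then obtain rest where es: "es = pre @ rev ds @ rest"
    using pre(1) d by simp
  have len: "length ds = a" "length cls = a"
    using a by (simp_all add: ds_def cls_def)
  have s: "s = length pre + a"
    using pre(2) k by (simp add: s_def a_def sum_list_take_Suc)
  have ia: "i \<le> a" using i by (simp add: a_def)
  have u: "u = cls ! (i - 1)" "u \<in> set ?B"
    using i ia a by (auto simp: u_def cls_def)
  have dsu: "ds ! (i - 1) = degree (subtree T u)"
    using u deg i ia len by (simp add: ds_def)
  have si: "s - i = length pre + (a - i)"
    using s ia by simp
  have "es ! (s - i) = rev ds ! (a - i)"
    using i ia len unfolding es si by (simp only: nth_append_length_plus) (simp add: nth_append)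
  also have "\<dots> = ds ! (i - 1)"
    using i ia len by (simp add: rev_nth)
  finally show "es ! (s - i) = degree (subtree T u)"
    using dsu by simp
  have take: "sum_list (take (s - i) es) = sum_list pre + sum_list (drop i ds)"
    using ia len by (simp add: es si take_rev)
  assume pos: "0 < degree (subtree T u)"
  \<comment> \<open>The rightmost child of \<open>u\<close> closes the block of children of the
    first \<open>i\<close> nodes of the class, so its 1-based position among the active nodes is the
    length of this block.\<close>
  define j where "j = sum_list (take i ds)"
  define P where "P = concat (map (children T) (take i cls))"
  have A: "A = concat (map (children T) cls) @ drop a ?B"
    by (simp add: A_def active_after_Suc a_def cls_def)
  have "concat (map (children T) cls) = P @ concat (map (children T) (drop i cls))"
    unfolding P_def by (metis append_take_drop_id concat_append map_append)
  then have AP: "A = P @ concat (map (children T) (drop i cls)) @ drop a ?B"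
    using A by simp
  have P: "length P = j"
    by (simp add: P_def j_def ds_def length_concat take_map o_def)
  have "take i cls = take (i - 1) cls @ [u]"
    using i ia len u by (metis Suc_diff_1 Suc_le_lessD take_Suc_conv_app_nth)
  moreover have "children T u \<noteq> []"
    using pos deg u by fastforce
  ultimately have lastP: "P \<noteq> []" "last P = last (children T u)"
    by (simp_all add: P_def)
  have lenA: "length A = j + sum_list (drop i ds) + (length ?B - a)"
    using AP P by (simp add: length_concat o_def ds_def drop_map)
  have "A ! (j - 1) = last (children T u)"
    using lastP unfolding AP P[symmetric] by (simp add: last_conv_nth nth_append)
  moreover have "j \<in> {1..length A}"
    using lastP(1) P lenA by (cases P) auto
  moreover have "s + length A - j = degree T + sum_list (take (s - i) es)"
    using lenA take s a pre by simp
  ultimately show "\<exists>j \<in> {1..length A}. A ! (j - 1) = last (children T u) \<and>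
        s + length A - j = degree T + sum_list (take (s - i) es)"
    by blast
qed

lemma ex_block_of_index:
  "x < sum_list \<alpha> \<Longrightarrow> \<exists>k < length \<alpha>. sum_list (take k \<alpha>) \<le> x \<and> x < sum_list (take (Suc k) (\<alpha> :: nat list))"
proof (induction \<alpha> arbitrary: x)
  case (Cons a \<alpha>)
  show ?case
  proof (cases "x < a")
    case True
    then show ?thesis by (intro exI[of _ 0]) simp
  next
    case False
    then have "x - a < sum_list \<alpha>"
      using Cons.prems by simp
    from Cons.IH[OF this] obtain k
      where "k < length \<alpha>" "sum_list (take k \<alpha>) \<le> x - a" "x - a < sum_list (take (Suc k) \<alpha>)"
      by blast
    then show ?thesis
      using False by (intro exI[of _ "Suc k"]) auto
  qed
qed simp

lemma marked_points_iff:
  assumes LAC: "(T, \<alpha>) \<in> LAC n"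
  defines "es \<equiv> degree_word (kids T) \<alpha>"
  shows "(x, y) \<in> marked_points T \<alpha> \<longleftrightarrow>
    0 < x \<and> x \<le> n \<and> 0 < es ! (x - 1) \<and> y = degree T + sum_list (take (x - 1) es)"
proof
  have n: "sum_list \<alpha> = n" using LAC by (simp add: LAC_iff)
  have cls: "color_class T \<alpha> (Suc k) = take (\<alpha> ! k) (active_after T \<alpha> k)" for k
    by (rule LAC_color_class[OF LAC])
  have alen: "length (take (\<alpha> ! k) (active_after T \<alpha> k)) = \<alpha> ! k" if "k < length \<alpha>" for k
    using LAC_active_after_length[OF LAC that] by simp
  {
    assume "(x, y) \<in> marked_points T \<alpha>"
    then obtain k' i j u where *: "k' \<in> {1..length \<alpha>}" "x = sum_list (take k' \<alpha>) - i + 1"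
        "y = sum_list (take k' \<alpha>) + length (active_after T \<alpha> k') - j" "u \<in> internal_nodes T"
        "i \<in> {1..length (color_class T \<alpha> k')}" "color_class T \<alpha> k' ! (i - 1) = u"
        "j \<in> {1..length (active_after T \<alpha> k')}" "active_after T \<alpha> k' ! (j - 1) = last (children T u)"
      unfolding marked_points_def by auto
    then obtain k where k': "k' = Suc k" and k: "k < length \<alpha>"
      by (cases k') auto
    have i: "0 < i" "i \<le> \<alpha> ! k"
      using * alen[OF k] by (auto simp: k' cls)
    have u: "u = active_after T \<alpha> k ! (i - 1)"
      using * i by (auto simp: k' cls)
    have node: "is_node T u" "u \<noteq> []" "children T u \<noteq> []"
      using * by (auto simp: internal_nodes_def nonroot_nodes_iff)
    then have pos: "0 < degree (subtree T u)"
      by (simp add: children_eq_Nil_iff)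
    obtain j' where j': "j' \<in> {1..length (active_after T \<alpha> k')}"
        "active_after T \<alpha> k' ! (j' - 1) = last (children T u)"
        "sum_list (take k' \<alpha>) + length (active_after T \<alpha> k') - j' =
          degree T + sum_list (take (sum_list (take k' \<alpha>) - i) es)"
      using marked_point_of_node(2)[OF LAC k i] pos u unfolding k' es_def by blast
    \<comment> \<open>An active node is listed only once, so the \<open>j\<close> of the definition
      is the computed one.\<close>
    have "j - 1 = j' - 1"
      using distinct_active_after[of T \<alpha> k'] j' * by (intro nth_eq_iff_index_eq[THEN iffD1]) auto
    then have "j = j'" using j' * by auto
    moreover have "es ! (x - 1) = degree (subtree T u)"
      using marked_point_of_node(1)[OF LAC k i] u * unfolding k' es_def by simp
    moreover have "sum_list (take k' \<alpha>) \<le> n"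
      using sum_list_take_mono[of k' "length \<alpha>" \<alpha>] * n by simp
    moreover have "i \<le> sum_list (take k' \<alpha>)"
      using i k by (simp add: k' sum_list_take_Suc)
    ultimately show "0 < x \<and> x \<le> n \<and> 0 < es ! (x - 1) \<and> y = degree T + sum_list (take (x - 1) es)"
      using * j' pos i by simp
  next
    assume x: "0 < x \<and> x \<le> n \<and> 0 < es ! (x - 1) \<and> y = degree T + sum_list (take (x - 1) es)"
    then have "x - 1 < sum_list \<alpha>" using n by auto
    from ex_block_of_index[OF this] obtain k
      where k: "k < length \<alpha>" "sum_list (take k \<alpha>) \<le> x - 1" "x - 1 < sum_list (take (Suc k) \<alpha>)"
      by blast
    define s where "s = sum_list (take (Suc k) \<alpha>)"
    \<comment> \<open>The columns of a color are assigned from right to left, so the index is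
      counted from the end of the block.\<close>
    define i where "i = s - (x - 1)"
    have i: "0 < i" "i \<le> \<alpha> ! k" "s - i = x - 1"
      using k by (auto simp: i_def s_def sum_list_take_Suc)
    define u where "u = active_after T \<alpha> k ! (i - 1)"
    have "i - 1 < length (active_after T \<alpha> k)"
      using i LAC_active_after_length[OF LAC k(1)] by simp
    then have node: "is_node T u" "u \<noteq> []"
      using active_after_nonroot[of u T \<alpha> k] by (auto simp: u_def)
    have pos: "0 < degree (subtree T u)"
      using marked_point_of_node(1)[OF LAC k(1) i(1,2)] x i(3) unfolding es_def u_def s_def by simp
    then have "u \<in> internal_nodes T"
      using node by (simp add: internal_nodes_def nonroot_nodes_iff children_eq_Nil_iff)
    moreover have "color_class T \<alpha> (Suc k) ! (i - 1) = u" "i \<in> {1..length (color_class T \<alpha> (Suc k))}"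
      using i alen[OF k(1)] by (auto simp: cls u_def)
    moreover from marked_point_of_node(2)[OF LAC k(1) i(1,2)] pos
    obtain j where "j \<in> {1..length (active_after T \<alpha> (Suc k))}"
        "active_after T \<alpha> (Suc k) ! (j - 1) = last (children T u)"
        "s + length (active_after T \<alpha> (Suc k)) - j = degree T + sum_list (take (s - i) es)"
      unfolding es_def u_def s_def by blast
    moreover have "x = s - i + 1" "Suc k \<in> {1..length \<alpha>}"
      using i x k by auto
    moreover have "y = degree T + sum_list (take (s - i) es)"
      using x i(3) by simp
    ultimately show "(x, y) \<in> marked_points T \<alpha>"
      unfolding marked_points_def
      by (intro CollectI exI[of _ "Suc k"] exI[of _ i] exI[of _ j] exI[of _ s]
          exI[of _ "length (active_after T \<alpha> (Suc k))"] exI[of _ u]) (simp add: s_def)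
  }
qed

text \<open>The root and the nodes give \<open>n + 1\<close> degrees for \<open>n\<close> columns;
  the surplus one is the last, which is \<open>0\<close>. The description by \<open>THE\<close> is
  legitimate because valleys determine a Dyck path.\<close>

lemma tree_path_eq:
  assumes LAC: "(T, \<alpha>) \<in> LAC n" and n: "0 < n"
  defines "ds \<equiv> butlast (degree T # degree_word (kids T) \<alpha>)"
  shows "tree_path n T \<alpha> = column_path ds"
    and "length ds = n" and "hd ds = degree T" and "tl ds @ [0] = degree_word (kids T) \<alpha>"
    and "(bounce_path \<alpha>, column_path ds) \<in> BP n"
proof -
  let ?es = "degree_word (kids T) \<alpha>"
  have col: "colorable (kids T) \<alpha>" and sum: "sum_list \<alpha> = n"
    using LAC by (simp_all add: LAC_iff)
  from col have feas: "feasible (degree T) \<alpha> ?es"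
    by (rule feasible_degree_word)
  have "\<alpha> \<noteq> []" using sum n by auto
  then have es: "?es \<noteq> []" "last ?es = 0"
    using feasible_last[OF feas] by auto
  then have ds: "ds = degree T # butlast ?es"
    by (simp add: ds_def)
  then show hd: "hd ds = degree T" by simp
  show tl: "tl ds @ [0] = ?es"
    using ds es by (metis append_butlast_last_id list.sel(3))
  have "length ?es = n"
    using feas sum by (simp add: feasible_iff)
  then show len: "length ds = n"
    using es n by (simp add: ds)
  show BP: "(bounce_path \<alpha>, column_path ds) \<in> BP n"
    using BP_column_path_iff[of \<alpha> ds] colorable_positive[OF col] feas sum len hd tl ds by simp
  then have dyck: "column_path ds \<in> dyck_paths n"
    by (simp add: BP_def nested_pairs_def)
  have "(x, y) \<in> valleys (column_path ds) \<longleftrightarrow> (x, y) \<in> marked_points T \<alpha>" for x y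
  proof -
    have nth: "ds ! x = ?es ! (x - 1)" "take x ds = degree T # take (x - 1) ?es" if "0 < x" "x < n"
      using that tl ds len by (cases x; simp add: nth_append[of "butlast ?es"] nth_butlast take_butlast)+
    \<comment> \<open>A marked point with \<open>x = n\<close> would not be a valley; it does not
      arise because the last degree vanishes.\<close>
    have lst: "?es ! (n - 1) = 0"
      using es \<open>length ?es = n\<close> by (metis last_conv_nth)
    show ?thesis
      unfolding valleys_column_path marked_points_iff[OF LAC] len
      using nth lst by (cases "x = n") auto
  qed
  then have "valleys (column_path ds) = marked_points T \<alpha>"
    by auto
  then show "tree_path n T \<alpha> = column_path ds"
    unfolding tree_path_def using dyck dyck_path_valleys_inject by (intro the_equality) auto
qed

lemma Xi_bounce_bij:
  assumes n: "0 < n"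
  shows "bij_betw Xi_bounce (LAC n) (BP n)"
  unfolding bij_betw_def
proof
  have Xi: "Xi_bounce (T, \<alpha>) = (bounce_path \<alpha>, column_path (butlast (degree T # degree_word (kids T) \<alpha>)))"
    if "(T, \<alpha>) \<in> LAC n" for T \<alpha>
    using that tree_path_eq(1)[OF that n] by (simp add: Xi_bounce_def LAC_iff)
  show "inj_on Xi_bounce (LAC n)"
  proof (rule inj_onI, clarify)
    fix T \<alpha> T' \<alpha>' assume L: "(T, \<alpha>) \<in> LAC n" "(T', \<alpha>') \<in> LAC n" and eq: "Xi_bounce (T, \<alpha>) = Xi_bounce (T', \<alpha>')"
    have col: "colorable (kids T) \<alpha>" "colorable (kids T') \<alpha>'"
      using L by (simp_all add: LAC_iff)
    have "bounce_path \<alpha> = bounce_path \<alpha>'"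
      using eq Xi[OF L(1)] Xi[OF L(2)] by simp
    then have \<alpha>: "\<alpha> = \<alpha>'"
      using col[THEN colorable_positive] bounce_columns_inject
      by (simp add: bounce_path_column_path column_path_inject)
    let ?ds = "butlast (degree T # degree_word (kids T) \<alpha>)"
    let ?ds' = "butlast (degree T' # degree_word (kids T') \<alpha>')"
    have "?ds = ?ds'"
      using eq Xi[OF L(1)] Xi[OF L(2)] column_path_inject by simp
    then have "degree T = degree T'" "degree_word (kids T) \<alpha> = degree_word (kids T') \<alpha>'"
      using tree_path_eq(3,4)[OF L(1) n] tree_path_eq(3,4)[OF L(2) n] by metis+
    then have "kids T = kids T'"
      using degree_word_inject col \<alpha> by blast
    then show "T = T' \<and> \<alpha> = \<alpha>'"
      using \<alpha> by (metis kids.simps ptree.exhaust)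
  qed
  show "Xi_bounce ` LAC n = BP n"
  proof
    show "Xi_bounce ` LAC n \<subseteq> BP n"
      using Xi tree_path_eq(5)[OF _ n] by auto
    show "BP n \<subseteq> Xi_bounce ` LAC n"
    proof
      fix pq assume pq: "pq \<in> BP n"
      then obtain \<alpha> q where p: "pq = (bounce_path \<alpha>, q)" "\<forall>a \<in> set \<alpha>. 0 < a"
        by (auto simp: BP_def bounce_def)
      then have dyck: "bounce_path \<alpha> \<in> dyck_paths n" "q \<in> dyck_paths n"
        using pq by (auto simp: BP_def nested_pairs_def)
      then have sum: "sum_list \<alpha> = n"
        using p by (simp add: bounce_path_column_path column_path_dyck_iff)
      obtain ds where q: "q = column_path ds"
        using dyck(2) by (rule dyck_path_column_path)
      then have ds: "length ds = n" "ds \<noteq> []"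
        using dyck n by (auto simp: column_path_dyck_iff)
      then have "feasible (hd ds) \<alpha> (tl ds @ [0])"
        using BP_column_path_iff[OF p(2), of ds] pq p q sum by simp
      then obtain F where F: "length F = hd ds" "colorable F \<alpha>" "degree_word F \<alpha> = tl ds @ [0]"
        using ex_forest_degree_word by blast
      then have L: "(Node F, \<alpha>) \<in> LAC n"
        using sum by (simp add: LAC_iff)
      have "butlast (degree (Node F) # degree_word (kids (Node F)) \<alpha>) = ds"
        using F ds by (simp add: butlast_append)
      then have "Xi_bounce (Node F, \<alpha>) = pq"
        using Xi[OF L] p q by simp
      then show "pq \<in> Xi_bounce ` LAC n"
        using L by (metis imageI)
    qed
  qed
qed


section \<open>Marked forests and marked words\<close>

text \<open>
  \<open>s\<close> is the current number of east-steps minus the number of unmarked north-steps, which is the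
  horizontal distance between the two paths encoded by the marked word.
\<close>

fun is_gain_word :: "int \<Rightarrow> marked_step list \<Rightarrow> bool" where
  "is_gain_word s [] = (0 \<le> s)"
| "is_gain_word s (N_marked # w) = (0 \<le> s \<and> is_gain_word s w)"
| "is_gain_word s (N_unmarked # w) = (0 \<le> s \<and> is_gain_word (s - 1) w)"
| "is_gain_word s (E_step # w) = (0 \<le> s \<and> is_gain_word (s + 1) w)"

definition gain :: "marked_step list \<Rightarrow> int" where
  "gain w = int (count_list w E_step) - int (count_list w N_unmarked)"

lemma gain_simps [simp]:
  "gain [] = 0" "gain (N_marked # w) = gain w" "gain (N_unmarked # w) = gain w - 1"
  "gain (E_step # w) = gain w + 1" "gain (u @ v) = gain u + gain v"
  by (simp_all add: gain_def)

lemma is_gain_word_nonneg: "is_gain_word s w \<Longrightarrow> 0 \<le> s \<and> 0 \<le> s + gain w"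
  by (induction s w rule: is_gain_word.induct) auto

lemma is_gain_word_append: "is_gain_word s (u @ v) \<longleftrightarrow> is_gain_word s u \<and> is_gain_word (s + gain u) v"
  by (induction s u rule: is_gain_word.induct) (auto dest: is_gain_word_nonneg simp: algebra_simps)

lemma is_gain_wordI:
  assumes "\<And>u v. w = u @ v \<Longrightarrow> 0 \<le> s + gain u"
  shows "is_gain_word s w"
  using assms
proof (induction w rule: rev_induct)
  case Nil
  then show ?case by simp
next
  case (snoc x w)
  have "is_gain_word s w"
    using snoc.prems by (intro snoc.IH) (metis append.assoc)
  moreover have "0 \<le> s + gain (w @ [x])" "0 \<le> s + gain w"
    using snoc.prems[of "w @ [x]" "[]"] snoc.prems[of w "[x]"] by simp_all
  ultimately show ?case
    by (cases x) (auto simp: is_gain_word_append)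
qed

section \<open>Parsing Dyck words into marked forests\<close>

fun stays_above :: "nat \<Rightarrow> path \<Rightarrow> bool" where
  "stays_above h [] = (h = 0)"
| "stays_above h (N # p) = stays_above (Suc h) p"
| "stays_above h (E # p) = (0 < h \<and> stays_above (h - 1) p)"

lemma all_append_Cons_iff:
  "(\<forall>u v. s # p = u @ v \<longrightarrow> P u) \<longleftrightarrow> P [] \<and> (\<forall>u v. p = u @ v \<longrightarrow> P (s # u))"
  by (auto simp: Cons_eq_append_conv)

lemma stays_above_iff:
  "stays_above h p \<longleftrightarrow> count_list p E = h + count_list p N \<and>
     (\<forall>u v. p = u @ v \<longrightarrow> count_list u E \<le> h + count_list u N)"
proof (induction h p rule: stays_above.induct)
  case (1 h)
  then show ?case by auto
next
  case (2 h p)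
  then show ?case unfolding all_append_Cons_iff by simp
next
  case (3 h p)
  show ?case
  proof (cases h)
    case 0
    \<comment> \<open>The empty prefix refutes the bound, in accordance with the guard
      \<open>0 < h\<close> of \<open>stays_above\<close>.\<close>
    have "\<not> (\<forall>u v. p = u @ v \<longrightarrow> Suc (count_list u E) \<le> count_list u N)"
    proof
      assume "\<forall>u v. p = u @ v \<longrightarrow> Suc (count_list u E) \<le> count_list u N"
      then have "Suc (count_list [] E) \<le> count_list ([] :: path) N" by blast
      then show False by simp
    qed
    then show ?thesis
      using 0 unfolding all_append_Cons_iff by simp
  next
    case (Suc h')
    then show ?thesis
      using 3 unfolding all_append_Cons_iff by simp
  qed
qed

lemma dyck_paths_stays_above_iff: "p \<in> dyck_paths n \<longleftrightarrow> stays_above 0 p \<and> count_list p N = n"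
  unfolding stays_above_iff by (auto simp: dyck_paths_iff)

datatype mtree = MNode (marked: bool) (mkids: "mtree list")

abbreviation north :: "bool \<Rightarrow> marked_step" where
  "north b \<equiv> if b then N_marked else N_unmarked"

primrec tree_word :: "mtree \<Rightarrow> marked_step list" where
  "tree_word (MNode b ts) = north b # concat (rev (map tree_word ts)) @ [E_step]"

definition forest_word :: "mtree list \<Rightarrow> marked_step list" where
  "forest_word G = concat (rev (map tree_word G))"

lemma tree_word_eq: "tree_word t = north (marked t) # forest_word (mkids t) @ [E_step]"
  by (cases t) (simp add: forest_word_def)

lemma forest_word_simps [simp]:
  "forest_word [] = []" "forest_word (t # G) = forest_word G @ tree_word t"
  "forest_word (G @ H) = forest_word H @ forest_word G"
  by (simp_all add: forest_word_def)

text \<open>A stack machine inverting \<open>forest_word\<close>. Siblings are visited from right to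
  left, so a finished tree is put in front of the trees already read; the stack keeps, for each open
  node, its mark and its right siblings. The last equation is a default for an unmatched
  east-step.\<close>

fun parse :: "(bool \<times> mtree list) list \<Rightarrow> mtree list \<Rightarrow> marked_step list \<Rightarrow> mtree list" where
  "parse st cur [] = cur"
| "parse st cur (N_marked # w) = parse ((True, cur) # st) [] w"
| "parse st cur (N_unmarked # w) = parse ((False, cur) # st) [] w"
| "parse ((b, sib) # st) cur (E_step # w) = parse st (MNode b cur # sib) w"
| "parse [] cur (E_step # w) = []"

lemma parse_tree_word: "parse st cur (tree_word t @ w) = parse st (t # cur) w"
proof (induction t arbitrary: st cur w)
  case (MNode b ts)
  have "parse st cur (forest_word us @ w) = parse st (us @ cur) w" if "set us \<subseteq> set ts" for us st cur w
    using that
  proof (induction us arbitrary: w)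
    case (Cons t us)
    then show ?case using MNode by simp
  qed simp
  then show ?case
    by (cases b) (simp_all add: tree_word_eq del: tree_word.simps)
qed

lemma parse_forest_word: "parse st cur (forest_word G @ w) = parse st (G @ cur) w"
  by (induction G arbitrary: w) (simp_all add: parse_tree_word)

lemma forest_word_inject: "forest_word G = forest_word H \<Longrightarrow> G = H"
  using parse_forest_word[of "[]" "[]" _ "[]"] by (metis append_Nil2 parse.simps(1))

text \<open>
  The part of a word read so far, if \<open>st\<close> lists the marks of the nodes whose traversal is not
  finished, each with the trees on its right that have the same parent.
\<close>

fun stack_word :: "(bool \<times> mtree list) list \<Rightarrow> marked_step list" where
  "stack_word [] = []"
| "stack_word ((b, sib) # st) = stack_word st @ forest_word sib @ [north b]"

text \<open>The word \<open>stack_word st @ forest_word cur @ w\<close> is unchanged when a letter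
  moves from \<open>w\<close> into the state of the parser, and the height of the path is the depth
  of the stack.\<close>

lemma ex_forest_word_aux:
  "stays_above (length st) (map forget_marking w) \<Longrightarrow>
     \<exists>G. forest_word G = stack_word st @ forest_word cur @ w"
proof (induction w arbitrary: st cur)
  case Nil
  then show ?case by auto
next
  case (Cons x w)
  show ?case
  proof (cases x)
    case N_marked
    then show ?thesis
      using Cons.IH[of "(True, cur) # st" "[]"] Cons.prems by simp
  next
    case N_unmarked
    then show ?thesis
      using Cons.IH[of "(False, cur) # st" "[]"] Cons.prems by simp
  next
    case E_step
    then obtain b sib st' where "st = (b, sib) # st'"
      using Cons.prems by (cases st) auto
    then show ?thesis
      using Cons.IH[of st' "MNode b cur # sib"] Cons.prems E_step
      by (simp add: tree_word_eq del: tree_word.simps)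
  qed
qed

lemma ex_forest_word: "stays_above 0 (map forget_marking w) \<Longrightarrow> \<exists>G. forest_word G = w"
  using ex_forest_word_aux[of "[]" w "[]"] by simp

lemma stays_above_tree_word:
  "stays_above h (map forget_marking (tree_word t) @ p) \<longleftrightarrow> stays_above h p"
proof (induction t arbitrary: h p)
  case (MNode b ts)
  have "stays_above h (map forget_marking (forest_word us) @ p) \<longleftrightarrow> stays_above h p"
    if "set us \<subseteq> set ts" for us h p
    using that
  proof (induction us arbitrary: p)
    case (Cons t us)
    then show ?case using MNode by simp
  qed simp
  then show ?case
    by (cases b) (simp_all add: tree_word_eq del: tree_word.simps)
qed

lemma stays_above_forest_word: "stays_above 0 (map forget_marking (forest_word G))"
proof -
  have "stays_above 0 (map forget_marking (forest_word G) @ p) \<longleftrightarrow> stays_above 0 p" for p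
    by (induction G arbitrary: p) (simp_all add: stays_above_tree_word)
  from this[of "[]"] show ?thesis by simp
qed

text \<open>The procedure with the parts read off from the marks instead of prescribed. It is a
  relation because a nonempty forest without a marked root admits no step; the \<open>Suc\<close>
  counts the marked tree that closes the group.\<close>

inductive coloring :: "mtree list \<Rightarrow> nat list \<Rightarrow> bool" where
  coloring_Nil: "coloring [] []"
| coloring_step: "\<lbrakk>\<forall>t \<in> set us. \<not> marked t; marked m;
    coloring (concat (map mkids us) @ mkids m @ rest) \<alpha>\<rbrakk>
    \<Longrightarrow> coloring (us @ m # rest) (Suc (length us) # \<alpha>)"

primrec forget :: "mtree \<Rightarrow> ptree" where
  "forget (MNode b ts) = Node (map forget ts)"

lemma kids_forget: "kids (forget t) = map forget (mkids t)"
  by (cases t) simp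

lemma map_forget_step:
  "forest_step (Suc (length us)) (map forget (us @ m # rest)) =
     map forget (concat (map mkids us) @ mkids m @ rest)"
  by (simp add: forest_step_def kids_forget map_concat o_def)

lemma colorable_forget: "coloring G \<alpha> \<Longrightarrow> colorable (map forget G) \<alpha>"
proof (induction rule: coloring.induct)
  case (coloring_step us m rest \<alpha>)
  then show ?case
    unfolding colorable.simps map_forget_step by simp
qed simp

lemma takeWhile_unmarked:
  "\<forall>t \<in> set us. \<not> marked t \<Longrightarrow> marked m \<Longrightarrow> takeWhile (\<lambda>t. \<not> marked t) (us @ m # rest) = us"
  by (induction us) auto

lemma coloring_deterministic: "coloring G \<alpha> \<Longrightarrow> coloring G \<beta> \<Longrightarrow> \<alpha> = \<beta>"
proof (induction arbitrary: \<beta> rule: coloring.induct)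
  case coloring_Nil
  then show ?case by (auto elim: coloring.cases)
next
  case (coloring_step us m rest \<alpha>)
  from coloring_step.prems show ?case
  proof (cases rule: coloring.cases)
    case (coloring_step us' m' rest' \<alpha>')
    then have "us = us'"
      using takeWhile_unmarked[of us m rest] takeWhile_unmarked[of us' m' rest']
        coloring_step.hyps \<open>\<forall>t \<in> set us. \<not> marked t\<close> \<open>marked m\<close> by simp
    then show ?thesis
      using coloring_step local.coloring_step.IH by simp
  qed simp
qed

text \<open>The part fixes the size of the group and hence the marks of its roots: only the last one
  is marked. All deeper marks occur in the forest after the step, which is known by induction and is
  cut back into lists of children by the common underlying trees.\<close>

lemma coloring_unique_marking:
  "coloring G \<alpha> \<Longrightarrow> coloring H \<alpha> \<Longrightarrow> map forget G = map forget H \<Longrightarrow> G = H"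
proof (induction arbitrary: H rule: coloring.induct)
  case coloring_Nil
  then show ?case by simp
next
  case (coloring_step us m rest \<alpha>)
  from coloring_step.prems(1) obtain us' m' rest' where H: "H = us' @ m' # rest'"
    and len: "length us = length us'" and un: "\<forall>t \<in> set us'. \<not> marked t" and m': "marked m'"
    and col: "coloring (concat (map mkids us') @ mkids m' @ rest') \<alpha>"
    by (cases rule: coloring.cases) auto
  have "map forget us = map forget us'" "forget m = forget m'" "map forget rest = map forget rest'"
    using coloring_step.prems(2) len by (simp_all add: H)
  then have fus: "map kids (map forget us) = map kids (map forget us')"
    and fm: "kids (forget m) = kids (forget m')" and fr: "map forget rest = map forget rest'"
    by simp_all
  have "map forget (concat (map mkids us) @ mkids m @ rest) =
      map forget (concat (map mkids us') @ mkids m' @ rest')"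
    unfolding map_forget_step[symmetric] using coloring_step.prems(2) len by (simp add: H)
  then have eq: "concat (map mkids us) @ mkids m @ rest = concat (map mkids us') @ mkids m' @ rest'"
    using coloring_step.IH[OF col] by simp
  have lens: "map (\<lambda>t. length (mkids t)) us = map (\<lambda>t. length (mkids t)) us'"
    using arg_cong[OF fus, of "map length"] by (simp add: kids_forget o_def)
  then have "length (concat (map mkids us)) = length (concat (map mkids us'))"
    by (simp add: length_concat o_def)
  moreover have "length (mkids m) = length (mkids m')"
    using arg_cong[OF fm, of length] by (simp add: kids_forget)
  ultimately have concat: "concat (map mkids us) = concat (map mkids us')"
    and mk: "mkids m = mkids m'" and rest: "rest = rest'"
    using eq by simp_all
  have mus: "map mkids us = map mkids us'"
  proof (rule concat_injective[OF concat])
    have "length (mkids (us ! i)) = length (mkids (us' ! i))" if "i < length us" for i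
      using arg_cong[OF lens, of "\<lambda>xs. xs ! i"] that len by simp
    then show "\<forall>(x, y) \<in> set (zip (map mkids us) (map mkids us')). length x = length y"
      using len by (auto simp: set_zip)
  qed (simp add: len)
  have "us = us'"
  proof (rule nth_equalityI[OF len])
    fix i assume i: "i < length us"
    then have "mkids (us ! i) = mkids (us' ! i)"
      using arg_cong[OF mus, of "\<lambda>xs. xs ! i"] len by simp
    then show "us ! i = us' ! i"
      using i len un coloring_step.hyps(1) by (simp add: mtree.expand)
  qed
  moreover have "m = m'"
    using mk m' coloring_step.hyps(2) by (simp add: mtree.expand)
  ultimately show ?case
    using rest by (simp add: H)
qed

text \<open>An unmarked tree lowers the level by one on entry and restores it on exit, so its
  content is read one level lower. The extra unit in \<open>s + 1\<close> will be supplied by the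
  closing east-step of the marked tree to the right of \<open>us\<close>, which is traversed just
  before.\<close>

lemma forest_word_unmarked:
  assumes "\<forall>t \<in> set us. \<not> marked t"
  shows "gain (forest_word us) = gain (forest_word (concat (map mkids us)))"
    and "0 \<le> s \<Longrightarrow> is_gain_word (s + 1) (forest_word us) \<longleftrightarrow>
      is_gain_word s (forest_word (concat (map mkids us)))"
    and "count_list (forest_word us) N_marked = count_list (forest_word (concat (map mkids us))) N_marked"
  using assms
proof (induction us)
  case (Cons t us)
  {
    case 1
    then show ?case using Cons by (simp add: tree_word_eq)
  next
    case 2
    then show ?case
      using Cons by (auto simp: tree_word_eq is_gain_word_append dest: is_gain_word_nonneg)
  next
    case 3
    then show ?case using Cons by (simp add: tree_word_eq)
  }
qed simp_all

text \<open>
  Removing the first group of roots does not change the slack of the remaining steps: the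
  east-step closing each removed tree cancels the unmarked root that is visited next.
\<close>

lemma is_gain_word_step:
  assumes "\<forall>t \<in> set us. \<not> marked t" "marked m"
  shows "is_gain_word s (forest_word (us @ m # rest)) \<longleftrightarrow>
    is_gain_word s (forest_word (concat (map mkids us) @ mkids m @ rest))"
  using assms forest_word_unmarked(2)[OF assms(1), of "s + gain (forest_word rest) + gain (forest_word (mkids m))"]
  by (auto simp: tree_word_eq is_gain_word_append add.assoc dest: is_gain_word_nonneg)

lemma coloring_is_gain_word: "coloring G \<alpha> \<Longrightarrow> is_gain_word 0 (forest_word G)"
  by (induction rule: coloring.induct) (simp_all only: is_gain_word_step, simp)

lemma coloring_count_marked: "coloring G \<alpha> \<Longrightarrow> count_list (forest_word G) N_marked = length \<alpha>"
  by (induction rule: coloring.induct) (simp_all add: tree_word_eq forest_word_unmarked(3))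

lemma count_N_forest_word_kids:
  "count_list (map forget_marking (forest_word us)) N =
     length us + count_list (map forget_marking (forest_word (concat (map mkids us)))) N"
  by (induction us) (simp_all add: tree_word_eq)

lemma coloring_count_N:
  "coloring G \<alpha> \<Longrightarrow> count_list (map forget_marking (forest_word G)) N = sum_list \<alpha>"
proof (induction rule: coloring.induct)
  case (coloring_step us m rest \<alpha>)
  then show ?case
    using count_N_forest_word_kids[of us] by (simp add: tree_word_eq)
qed simp

text \<open>The traversal starts with the last root at level 0, where an unmarked north-step would
  lead below 0. So the last root of a nonempty forest is marked, a first marked root exists, and a
  step can be made; it removes nodes and keeps the gain condition.\<close>

lemma ex_coloring: "is_gain_word 0 (forest_word G) \<Longrightarrow> \<exists>\<alpha>. coloring G \<alpha>"
proof (induction "count_list (map forget_marking (forest_word G)) N" arbitrary: G rule: less_induct)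
  case less
  show ?case
  proof (cases "G = []")
    case True
    then show ?thesis using coloring_Nil by blast
  next
    case False
    then have "forest_word G = forest_word [last G] @ forest_word (butlast G)"
      by (metis append_butlast_last_id forest_word_simps(3))
    then have "marked (last G)"
      using less.prems by (auto simp: tree_word_eq is_gain_word_append dest: is_gain_word_nonneg split: if_splits)
    then obtain us m rest where G: "G = us @ m # rest" "marked m" "\<forall>t \<in> set us. \<not> marked t"
      using split_list_first_prop[of G marked] False last_in_set by blast
    let ?H = "concat (map mkids us) @ mkids m @ rest"
    have "count_list (map forget_marking (forest_word ?H)) N <
        count_list (map forget_marking (forest_word G)) N"
      using count_N_forest_word_kids[of us] G by (simp add: tree_word_eq)
    moreover have "is_gain_word 0 (forest_word ?H)"
      using less.prems G is_gain_word_step by blast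
    ultimately obtain \<alpha> where "coloring ?H \<alpha>"
      using less.hyps by blast
    then show ?thesis
      using G coloring_step by blast
  qed
qed


section \<open>The marking defined by a left-aligned coloring\<close>

text \<open>The recursion yields a function of the marking, so that addresses can be made relative
  to a child on entering it.\<close>

primrec mark_tree :: "ptree \<Rightarrow> (node \<Rightarrow> bool) \<Rightarrow> mtree" where
  "mark_tree (Node ts) = (\<lambda>m. MNode (m [])
     (map2 (\<lambda>i f. f (\<lambda>u. m (i # u))) [0..<length ts] (map mark_tree ts)))"

lemma mark_tree_Node:
  "mark_tree (Node ts) m = MNode (m []) (map (\<lambda>i. mark_tree (ts ! i) (\<lambda>u. m (i # u))) [0..<length ts])"
  by (simp add: map2_upt_map)

declare mark_tree.simps [simp del]

lemma marked_mark_tree [simp]: "marked (mark_tree T m) = m []"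
  by (cases T) (simp add: mark_tree_Node)

lemma mkids_mark_tree:
  "mkids (mark_tree T m) = map (\<lambda>i. mark_tree (kids T ! i) (\<lambda>u. m (i # u))) [0..<length (kids T)]"
  by (cases T) (simp add: mark_tree_Node)

lemma forget_mark_tree [simp]: "forget (mark_tree T m) = T"
proof (induction T arbitrary: m)
  case (Node ts)
  then show ?case
    by (simp add: mark_tree_Node) (rule nth_equalityI, auto)
qed

fun mark_move :: "(node \<Rightarrow> bool) \<Rightarrow> move \<Rightarrow> marked_step" where
  "mark_move m (Visit u) = north (m u)"
| "mark_move m Return = E_step"

lemma mark_move_in_child: "mark_move m (in_child i x) = mark_move (\<lambda>u. m (i # u)) x"
  by (cases x) auto

lemma traversal_RL_Node:
  "traversal_RL (Node ts) = concat (map (\<lambda>i. [Visit [i]] @ map (in_child i) (traversal_RL (ts ! i)) @ [Return])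
     (rev [0..<length ts]))"
  by (simp add: map2_upt_map rev_map)

declare traversal_RL.simps [simp del]

lemma forest_word_mark_tree:
  "forest_word (mkids (mark_tree T m)) = map (mark_move m) (traversal_RL T)"
proof (induction T arbitrary: m)
  case (Node ts)
  have "tree_word (mark_tree (ts ! i) (\<lambda>u. m (i # u))) =
      map (mark_move m) ([Visit [i]] @ map (in_child i) (traversal_RL (ts ! i)) @ [Return])"
    if "i < length ts" for i
    using Node that by (simp add: tree_word_eq mark_move_in_child o_def)
  then have *: "map (\<lambda>i. tree_word (mark_tree (ts ! i) (\<lambda>u. m (i # u)))) (rev [0..<length ts]) =
      map (\<lambda>i. map (mark_move m) ([Visit [i]] @ map (in_child i) (traversal_RL (ts ! i)) @ [Return]))
        (rev [0..<length ts])"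
    by (intro map_cong) auto
  have "forest_word (mkids (mark_tree (Node ts) m)) =
      concat (map (\<lambda>i. tree_word (mark_tree (ts ! i) (\<lambda>u. m (i # u)))) (rev [0..<length ts]))"
    by (simp add: forest_word_def mkids_mark_tree rev_map o_def)
  also have "\<dots> = map (mark_move m) (traversal_RL (Node ts))"
    unfolding * by (simp add: traversal_RL_Node map_concat o_def)
  finally show ?case .
qed

section \<open>The order of visits and first occurrences of colors\<close>

fun visits :: "move list \<Rightarrow> node list" where
  "visits [] = []"
| "visits (Visit u # w) = u # visits w"
| "visits (Return # w) = visits w"

lemma visits_append [simp]: "visits (u @ v) = visits u @ visits v"
  by (induction u rule: visits.induct) auto

lemma visits_in_child [simp]: "visits (map (in_child i) w) = map ((#) i) (visits w)"
  by (induction w rule: visits.induct) auto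

lemma visits_concat: "visits (concat ws) = concat (map visits ws)"
  by (induction ws) auto

lemma visits_traversal_Node:
  "visits (traversal_RL (Node ts)) =
     concat (map (\<lambda>i. [i] # map ((#) i) (visits (traversal_RL (ts ! i)))) (rev [0..<length ts]))"
  by (simp add: traversal_RL_Node visits_concat o_def)

lemma mem_visits_traversal: "u \<in> set (visits (traversal_RL T)) \<longleftrightarrow> u \<noteq> [] \<and> is_node T u"
proof (induction T arbitrary: u)
  case (Node ts)
  have "u \<in> set (visits (traversal_RL (Node ts))) \<longleftrightarrow>
      (\<exists>i < length ts. u = [i] \<or> (\<exists>v \<in> set (visits (traversal_RL (ts ! i))). u = i # v))"
    by (auto simp: visits_traversal_Node)
  also have "\<dots> \<longleftrightarrow> (\<exists>i < length ts. u = [i] \<or> (\<exists>v. v \<noteq> [] \<and> is_node (ts ! i) v \<and> u = i # v))"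
    using Node by (intro ex_cong1 conj_cong refl) (auto simp: nth_mem)
  also have "\<dots> \<longleftrightarrow> u \<noteq> [] \<and> is_node (Node ts) u"
    by (cases u) auto
  finally show ?case .
qed

text \<open>Visiting children from right to left reverses the lexicographic order, except that an
  ancestor still comes before its descendants.\<close>

lemma sorted_visits_traversal:
  "sorted_wrt (\<lambda>u v. strict_prefix u v \<or> v < u) (visits (traversal_RL T))"
proof (induction T)
  case (Node ts)
  show ?case
    unfolding visits_traversal_Node
  proof (rule sorted_wrt_concat_map)
    fix i assume "i \<in> set (rev [0..<length ts])"
    then have "sorted_wrt (\<lambda>u v. strict_prefix u v \<or> v < u) (visits (traversal_RL (ts ! i)))"
      using Node by simp
    moreover have "strict_prefix [i] (i # u)" if "u \<in> set (visits (traversal_RL (ts ! i)))" for u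
      using that mem_visits_traversal[of u "ts ! i"] by (auto simp: strict_prefix_def)
    ultimately show "sorted_wrt (\<lambda>u v. strict_prefix u v \<or> v < u)
        ([i] # map ((#) i) (visits (traversal_RL (ts ! i))))"
      by (simp add: sorted_wrt_map)
  next
    show "sorted_wrt (\<lambda>x y. \<forall>u \<in> set ([x] # map ((#) x) (visits (traversal_RL (ts ! x)))).
        \<forall>v \<in> set ([y] # map ((#) y) (visits (traversal_RL (ts ! y)))). strict_prefix u v \<or> v < u)
        (rev [0..<length ts])"
      unfolding sorted_wrt_rev
      by (rule sorted_wrt_mono_rel[OF _ sorted_wrt_upt]) auto
  qed
qed

text \<open>The colors seen before \<open>u\<close> are those in \<open>S\<close> and those of the
  prefix \<open>ps\<close>; the accumulator is thereby traded for a property of the node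
  alone.\<close>

lemma mark_moves_eq:
  assumes "\<And>ps u qs. visits w = ps @ u # qs \<Longrightarrow> m u \<longleftrightarrow> c u \<notin> S \<union> c ` set ps"
  shows "mark_moves c S w = map (mark_move m) w"
  using assms
proof (induction c S w rule: mark_moves.induct)
  case (2 c S u w)
  have "m u \<longleftrightarrow> c u \<notin> S"
    using 2(2)[of "[]" u "visits w"] by simp
  moreover have "mark_moves c (insert (c u) S) w = map (mark_move m) w"
  proof (rule 2(1))
    fix ps v qs assume "visits w = ps @ v # qs"
    then show "m v \<longleftrightarrow> c v \<notin> insert (c u) S \<union> c ` set ps"
      using 2(2)[of "u # ps" v qs] by auto
  qed
  ultimately show ?case by simp
qed simp_all

definition last_of_color :: "ptree \<Rightarrow> nat list \<Rightarrow> node \<Rightarrow> bool" where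
  "last_of_color T \<alpha> u \<longleftrightarrow> (\<exists>k < length \<alpha>. u = active_after T \<alpha> k ! (\<alpha> ! k - 1))"

lemma LAC_last_of_color_iff:
  assumes LAC: "(T, \<alpha>) \<in> LAC n" and k: "k < length \<alpha>"
    and u: "u \<in> set (take (\<alpha> ! k) (active_after T \<alpha> k))"
  shows "last_of_color T \<alpha> u \<longleftrightarrow> u = active_after T \<alpha> k ! (\<alpha> ! k - 1)"
proof
  assume "last_of_color T \<alpha> u"
  then obtain k' where k': "k' < length \<alpha>" "u = active_after T \<alpha> k' ! (\<alpha> ! k' - 1)"
    by (auto simp: last_of_color_def)
  have "0 < \<alpha> ! k'" "\<alpha> ! k' \<le> length (active_after T \<alpha> k')"
    using LAC_active_after_length[OF LAC k'(1)] LAC k'(1) by (auto simp: LAC_def compositions_def)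
  then have "u \<in> set (take (\<alpha> ! k') (active_after T \<alpha> k'))"
    unfolding k'(2) by (auto simp: in_set_conv_nth intro!: exI[of _ "\<alpha> ! k' - 1"])
  moreover have "u \<noteq> []" "is_node T u"
    using active_after_nonroot[OF in_set_takeD[OF u]] by auto
  ultimately have "Suc k = Suc k'"
    using u LAC_color_eq_iff[OF LAC] by metis
  then show "u = active_after T \<alpha> k ! (\<alpha> ! k - 1)"
    using k' by simp
qed (use k in \<open>auto simp: last_of_color_def\<close>)

text \<open>A color class consists of nodes active at the same time, hence is an antichain. On it
  the traversal order is the exact reverse of LR-prefix order, so its color is first seen at its
  last node.\<close>

lemma marked_word_eq:
  assumes LAC: "(T, \<alpha>) \<in> LAC n"
  shows "marked_word T \<alpha> = map (mark_move (last_of_color T \<alpha>)) (traversal_RL T)"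
  unfolding marked_word_def
proof (rule mark_moves_eq)
  fix ps u qs assume split: "visits (traversal_RL T) = ps @ u # qs"
  have before: "strict_prefix v u \<or> u < v" if "v \<in> set ps" for v
    using that sorted_visits_traversal[of T] by (auto simp: split sorted_wrt_append)
  have after: "strict_prefix u v \<or> v < u" if "v \<in> set qs" for v
    using that sorted_visits_traversal[of T] by (auto simp: split sorted_wrt_append)
  have node: "v \<noteq> [] \<and> is_node T v" if "v \<in> insert u (set ps)" for v
    using that mem_visits_traversal[of v T] by (auto simp: split)
  obtain k where k: "k < length \<alpha>" "color T \<alpha> u = Suc k"
    using LAC_color_cases[OF LAC] node by blast
  define A where "A = active_after T \<alpha> k"
  define a where "a = \<alpha> ! k"
  define l where "l = A ! (a - 1)"
  have a: "0 < a" "a \<le> length A"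
    using LAC_active_after_length[OF LAC k(1)] LAC k(1) by (auto simp: LAC_def compositions_def a_def A_def)
  have u: "u \<in> set (take a A)"
    using LAC_color_eq_iff[OF LAC, of u k] node k by (simp add: a_def A_def)
  have l: "l \<in> set (take a A)"
    using a by (auto simp: l_def in_set_conv_nth intro!: exI[of _ "a - 1"])
  have anti: "\<not> strict_prefix v v'" if "v \<in> set (take a A)" "v' \<in> set (take a A)" for v v'
    using that active_antichain[OF ancestor_closed_colored, of v T \<alpha> k v']
    by (auto simp: A_def active_after_def strict_prefix_def dest: in_set_takeD)
  have max: "v \<le> l" if v: "v \<in> set (take a A)" for v
  proof -
    obtain j where j: "j < a" "v = A ! j"
      using v a by (auto simp: in_set_conv_nth)
    have "sorted A"
      using sorted_active_after[of T \<alpha> k] by (simp add: A_def strict_sorted_iff)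
    then show ?thesis
      using j a by (auto simp: l_def intro: sorted_nth_mono)
  qed
  have m: "last_of_color T \<alpha> u \<longleftrightarrow> u = l"
    using LAC_last_of_color_iff[OF LAC k(1)] u by (simp add: l_def A_def a_def)
  have same: "v \<in> set (take a A) \<longleftrightarrow> color T \<alpha> v = color T \<alpha> u" if "v \<noteq> []" "is_node T v" for v
    using LAC_color_eq_iff[OF LAC that] k by (simp add: a_def A_def)
  have lnode: "l \<noteq> []" "is_node T l"
    using active_after_nonroot[of l T \<alpha> k] l by (auto simp: A_def dest: in_set_takeD)
  have "u = l \<longleftrightarrow> color T \<alpha> u \<notin> color T \<alpha> ` set ps"
  proof
    assume "u = l"
    show "color T \<alpha> u \<notin> color T \<alpha> ` set ps"
    proof
      assume "color T \<alpha> u \<in> color T \<alpha> ` set ps"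
      then obtain v where v: "v \<in> set ps" "color T \<alpha> v = color T \<alpha> u" by auto
      then have "v \<in> set (take a A)" using same node by auto
      then show False
        using before[OF v(1)] anti[of v u] u max[of v] \<open>u = l\<close> by auto
    qed
  next
    assume *: "color T \<alpha> u \<notin> color T \<alpha> ` set ps"
    show "u = l"
    proof (rule ccontr)
      assume "u \<noteq> l"
      have "l \<in> set (visits (traversal_RL T))"
        using lnode by (simp add: mem_visits_traversal)
      moreover have "l \<notin> set ps"
        using * same[OF lnode] l by (metis imageI)
      ultimately have "l \<in> set qs"
        using \<open>u \<noteq> l\<close> by (simp add: split)
      then show False
        using after anti[OF u l] max[OF u] \<open>u \<noteq> l\<close> by (meson leD)
    qed
  qed
  then show "last_of_color T \<alpha> u \<longleftrightarrow> color T \<alpha> u \<notin> {} \<union> color T \<alpha> ` set ps"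
    using m by simp
qed

section \<open>The correspondence between LAC trees and marked words\<close>

definition marked_subtree :: "ptree \<Rightarrow> (node \<Rightarrow> bool) \<Rightarrow> node \<Rightarrow> mtree" where
  "marked_subtree T m u = mark_tree (subtree T u) (\<lambda>v. m (u @ v))"

lemma mkids_marked_subtree:
  "is_node T u \<Longrightarrow> mkids (marked_subtree T m u) = map (marked_subtree T m) (children T u)"
  by (simp add: marked_subtree_def mkids_mark_tree children_eq o_def subtree_append)

text \<open>Among the active nodes colored in a step exactly the last is marked, so cutting the
  forest after its first marked tree yields the prescribed group.\<close>

lemma LAC_coloring:
  assumes LAC: "(T, \<alpha>) \<in> LAC n" and "j \<le> length \<alpha>"
  shows "coloring (map (marked_subtree T (last_of_color T \<alpha>)) (active_after T \<alpha> j)) (drop j \<alpha>)"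
    (is "coloring (map ?M _) _")
  using assms(2)
proof (induction j rule: inc_induct)
  case base
  have "active_after T \<alpha> (length \<alpha>) = []"
    using LAC_colorable[OF LAC, of "length \<alpha>"] by (simp add: active_forest_def)
  then show ?case by (simp add: coloring_Nil)
next
  case (step k)
  let ?A = "active_after T \<alpha> k"
  define b where "b = \<alpha> ! k - 1"
  have a: "\<alpha> ! k = Suc b" "b < length ?A"
    using LAC_active_after_length[OF LAC step(2)] LAC nth_mem[OF step(2)]
    by (auto simp: LAC_def compositions_def b_def)
  have A: "?A = take b ?A @ ?A ! b # drop (Suc b) ?A"
    using a by (simp add: id_take_nth_drop)
  have tk: "take (\<alpha> ! k) ?A = take b ?A @ [?A ! b]"
    using a by (simp add: take_Suc_conv_app_nth)
  have marks: "marked (?M u) \<longleftrightarrow> u = ?A ! b" if "u \<in> set (take (\<alpha> ! k) ?A)" for u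
    using LAC_last_of_color_iff[OF LAC _ that] step a by (simp add: marked_subtree_def)
  have mk: "mkids (?M u) = map ?M (children T u)" if "u \<in> set ?A" for u
    using active_after_nonroot[OF that] by (simp add: mkids_marked_subtree)
  have "?A ! b \<notin> set (take b ?A)"
    using distinct_active_after[of T \<alpha> k] by (subst (asm) A) simp
  then have "\<forall>t \<in> set (map ?M (take b ?A)). \<not> marked t"
    using marks by (auto simp: tk)
  moreover have "marked (?M (?A ! b))"
    using marks by (simp add: tk)
  moreover have "map ?M (active_after T \<alpha> (Suc k)) =
      concat (map mkids (map ?M (take b ?A))) @ mkids (?M (?A ! b)) @ map ?M (drop (Suc b) ?A)"
  proof -
    have "concat (map (\<lambda>u. mkids (?M u)) (take b ?A)) = concat (map (\<lambda>u. map ?M (children T u)) (take b ?A))"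
      by (intro arg_cong[where f = concat] map_cong refl mk) (auto dest: in_set_takeD)
    then show ?thesis
      using a mk[of "?A ! b"] by (simp add: active_after_Suc tk[unfolded a(1)] map_concat o_def)
  qed
  ultimately have "coloring (map ?M (take b ?A) @ ?M (?A ! b) # map ?M (drop (Suc b) ?A))
      (Suc (length (map ?M (take b ?A))) # drop (Suc k) \<alpha>)"
    using step.IH by (intro coloring_step) simp_all
  moreover have "map ?M ?A = map ?M (take b ?A) @ ?M (?A ! b) # map ?M (drop (Suc b) ?A)"
    by (subst A) simp
  moreover have "drop k \<alpha> = Suc (length (map ?M (take b ?A))) # drop (Suc k) \<alpha>"
    using a step by (simp add: Cons_nth_drop_Suc[symmetric])
  ultimately show ?case by simp
qed

lemma LAC_ex_coloring:
  assumes LAC: "(T, \<alpha>) \<in> LAC n"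
  obtains G where "coloring G \<alpha>" "map forget G = kids T" "marked_word T \<alpha> = forest_word G"
proof
  let ?G = "map (marked_subtree T (last_of_color T \<alpha>)) (children T [])"
  show "coloring ?G \<alpha>"
    using LAC_coloring[OF LAC, of 0] by (simp add: active_after_0)
  show "map forget ?G = kids T"
    using map_subtree_children[of T "[]"] by (simp add: marked_subtree_def o_def)
  have "?G = mkids (mark_tree T (last_of_color T \<alpha>))"
    using mkids_marked_subtree[of T "[]"] by (simp add: marked_subtree_def)
  then show "marked_word T \<alpha> = forest_word ?G"
    using marked_word_eq[OF LAC] forest_word_mark_tree by simp
qed

definition gain_words :: "nat \<Rightarrow> marked_step list set" where
  "gain_words n = {w. map forget_marking w \<in> dyck_paths n \<and> is_gain_word 0 w}"

lemma bij_betw_marked_word: "bij_betw (\<lambda>(T, \<alpha>). marked_word T \<alpha>) (LAC n) (gain_words n)"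
  unfolding bij_betw_def
proof
  show "inj_on (\<lambda>(T, \<alpha>). marked_word T \<alpha>) (LAC n)"
  proof (rule inj_onI, clarify)
    fix T \<alpha> T' \<alpha>' assume L: "(T, \<alpha>) \<in> LAC n" "(T', \<alpha>') \<in> LAC n"
      and eq: "marked_word T \<alpha> = marked_word T' \<alpha>'"
    obtain G where G: "coloring G \<alpha>" "map forget G = kids T" "marked_word T \<alpha> = forest_word G"
      using L(1) by (rule LAC_ex_coloring)
    obtain G' where G': "coloring G' \<alpha>'" "map forget G' = kids T'" "marked_word T' \<alpha>' = forest_word G'"
      using L(2) by (rule LAC_ex_coloring)
    have "G = G'"
      using eq G G' forest_word_inject by simp
    then have "kids T = kids T'" "\<alpha> = \<alpha>'"
      using G G' coloring_deterministic by auto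
    then show "T = T' \<and> \<alpha> = \<alpha>'"
      by (metis kids.simps ptree.exhaust)
  qed
  show "(\<lambda>(T, \<alpha>). marked_word T \<alpha>) ` LAC n = gain_words n"
  proof
    show "(\<lambda>(T, \<alpha>). marked_word T \<alpha>) ` LAC n \<subseteq> gain_words n"
    proof clarify
      fix T \<alpha> assume L: "(T, \<alpha>) \<in> LAC n"
      obtain G where G: "coloring G \<alpha>" "marked_word T \<alpha> = forest_word G"
        using L by (rule LAC_ex_coloring)
      then show "marked_word T \<alpha> \<in> gain_words n"
        using L coloring_is_gain_word[OF G(1)] coloring_count_N[OF G(1)]
        by (simp add: gain_words_def dyck_paths_stays_above_iff stays_above_forest_word LAC_iff)
    qed
    show "gain_words n \<subseteq> (\<lambda>(T, \<alpha>). marked_word T \<alpha>) ` LAC n"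
    proof
      fix w assume "w \<in> gain_words n"
      then have w: "stays_above 0 (map forget_marking w)" "count_list (map forget_marking w) N = n"
          "is_gain_word 0 w"
        by (auto simp: gain_words_def dyck_paths_stays_above_iff)
      obtain G where G: "forest_word G = w"
        using ex_forest_word w(1) by blast
      obtain \<alpha> where \<alpha>: "coloring G \<alpha>"
        using ex_coloring w(3) G by blast
      have L: "(Node (map forget G), \<alpha>) \<in> LAC n"
        using colorable_forget[OF \<alpha>] coloring_count_N[OF \<alpha>] w(2) G by (simp add: LAC_iff)
      obtain H where H: "coloring H \<alpha>" "map forget H = kids (Node (map forget G))"
          "marked_word (Node (map forget G)) \<alpha> = forest_word H"
        using L by (rule LAC_ex_coloring)
      \<comment> \<open>The marking of the new LAC tree by the last nodes of its colors is not known
        beforehand to be that of \<open>G\<close>; both admit the same \<alpha> on the same tree,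
        which forces them to agree.\<close>
      have "H = G"
        using coloring_unique_marking[OF H(1) \<alpha>] H(2) by simp
      then have "w = (\<lambda>(T, \<alpha>). marked_word T \<alpha>) (Node (map forget G), \<alpha>)"
        using H(3) G by simp
      then show "w \<in> (\<lambda>(T, \<alpha>). marked_word T \<alpha>) ` LAC n"
        using L by (rule image_eqI)
    qed
  qed
qed

lemma LAC_count_marked:
  assumes "(T, \<alpha>) \<in> LAC n"
  shows "count_list (marked_word T \<alpha>) N_marked = length \<alpha>"
  using assms by (rule LAC_ex_coloring) (simp add: coloring_count_marked)


section \<open>Pairs with steep top path\<close>

abbreviation top_word :: "marked_step list \<Rightarrow> path" where
  "top_word w \<equiv> concat (map top_steps w)"

lemma count_top_word [simp]:
  "count_list (top_word w) N = count_list (map forget_marking w) N"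
  "count_list (top_word w) E = count_list w N_unmarked"
proof (induction w)
  case (Cons x w)
  {
    case 1
    then show ?case using Cons by (cases x) simp_all
  next
    case 2
    then show ?case using Cons by (cases x) simp_all
  }
qed simp_all

lemma count_forget_marking:
  "count_list (map forget_marking w) E = count_list w E_step"
  "count_list (map forget_marking w) N = count_list w N_marked + count_list w N_unmarked"
proof (induction w)
  case (Cons x w)
  {
    case 1
    then show ?case using Cons by (cases x) simp_all
  next
    case 2
    then show ?case using Cons by (cases x) simp_all
  }
qed simp_all

lemma stays_above_replicate_E: "stays_above h (replicate h E)"
  by (induction h) auto

text \<open>Here \<open>h\<close> is the height of the bottom path above the diagonal and
  \<open>s\<close> the horizontal distance between the two paths. As both have made the same
  north-steps, the top path is at height \<open>h + s\<close> above the diagonal.\<close>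

lemma stays_above_top_word:
  assumes "is_gain_word (int s) w" "stays_above h (map forget_marking w)"
  shows "stays_above (h + s)
    (top_word w @ replicate (h + s + count_list w N_marked) E)"
  using assms
proof (induction w arbitrary: h s)
  case Nil
  then show ?case by (simp add: stays_above_replicate_E)
next
  case (Cons x w)
  show ?case
  proof (cases x)
    case N_marked
    then show ?thesis
      using Cons.IH[of s "Suc h"] Cons.prems by simp
  next
    case N_unmarked
    then have g: "is_gain_word (int s - 1) w" using Cons.prems by simp
    then obtain s' where s: "s = Suc s'"
      using is_gain_word_nonneg by (cases s) fastforce+
    then show ?thesis
      using Cons.IH[of s' "Suc h"] Cons.prems g N_unmarked by simp
  next
    case E_step
    then obtain h' where "h = Suc h'"
      using Cons.prems by (cases h) auto
    then show ?thesis
      using Cons.IH[of "Suc s" h'] Cons.prems E_step by (simp add: add.commute)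
  qed
qed

section \<open>Steep paths as words in N and EN followed by east-steps\<close>

lemma steep_N: "steep (N # p) \<longleftrightarrow> steep p"
  unfolding steep_def by (auto simp: Cons_eq_append_conv)

lemma steep_E: "steep (E # p) \<longleftrightarrow> steep p \<and> \<not> (\<exists>q. p = E # q \<and> N \<in> set q)"
  unfolding steep_def by (auto simp: Cons_eq_append_conv)

lemma steep_replicate_E: "steep (replicate m E)"
proof -
  have "N \<notin> set (replicate m E)" by auto
  then show ?thesis
    unfolding steep_def by (metis Un_iff set_append)
qed

lemma steep_top_word: "steep (top_word w @ replicate m E)"
proof (induction w)
  case (Cons x w)
  then show ?case by (cases x) (simp_all add: steep_N steep_E)
qed (simp add: steep_replicate_E)

text \<open>Before the last north-step every east-step is directly followed by a north-step and
  forms a piece EN with it. The induction is on the length since such a piece takes two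
  letters.\<close>

lemma ex_steep_decomposition:
  "steep p \<Longrightarrow> \<exists>bs m. p = concat (map (\<lambda>b. top_steps (north b)) bs) @ replicate m E"
proof (induction p rule: length_induct)
  case (1 p)
  consider "p = []" | q where "p = N # q" | "p = [E]" | q where "p = E # N # q" | q where "p = E # E # q"
    by (metis list.exhaust step.exhaust)
  then show ?case
  proof cases
    case 1
    then show ?thesis by (intro exI[of _ "[]"] exI[of _ 0]) simp
  next
    case (2 q)
    then obtain bs m where "q = concat (map (\<lambda>b. top_steps (north b)) bs) @ replicate m E"
      using 1 by (auto simp: steep_N)
    then show ?thesis
      using 2 by (intro exI[of _ "True # bs"] exI[of _ m]) simp
  next
    case 3
    then show ?thesis by (intro exI[of _ "[]"] exI[of _ 1]) simp
  next
    case (4 q)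
    then obtain bs m where "q = concat (map (\<lambda>b. top_steps (north b)) bs) @ replicate m E"
      using 1(1)[rule_format, of q] 1(2) by (auto simp: steep_N steep_E)
    then show ?thesis
      using 4 by (intro exI[of _ "False # bs"] exI[of _ m]) simp
  next
    case (5 q)
    then have "N \<notin> set q"
      using 1 by (simp add: steep_E)
    then have "\<forall>x \<in> set q. x = E"
      by (metis step.exhaust)
    then have "q = replicate (length q) E"
      by (simp add: replicate_length_same)
    then show ?thesis
      using 5 by (intro exI[of _ "[]"] exI[of _ "Suc (Suc (length q))"]) simp
  qed
qed

lemma ex_marking:
  "count_list p N = length bs \<Longrightarrow>
     \<exists>w. map forget_marking w = p \<and> top_word w = concat (map (\<lambda>b. top_steps (north b)) bs)"
proof (induction p arbitrary: bs)
  case Nil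
  then show ?case by (intro exI[of _ "[]"]) simp
next
  case (Cons x p)
  show ?case
  proof (cases x)
    case E
    then obtain w where "map forget_marking w = p" "top_word w = concat (map (\<lambda>b. top_steps (north b)) bs)"
      using Cons.IH[of bs] Cons.prems by auto
    then show ?thesis
      using E by (intro exI[of _ "E_step # w"]) simp
  next
    case N
    then obtain b bs' where bs: "bs = b # bs'"
      using Cons.prems by (cases bs) auto
    then obtain w where "map forget_marking w = p" "top_word w = concat (map (\<lambda>b. top_steps (north b)) bs')"
      using Cons.IH[of bs'] Cons.prems N by auto
    then show ?thesis
      using N bs by (intro exI[of _ "north b # w"]) simp
  qed
qed

text \<open>The bottom path shows where the north-steps are, and at each of them the top path
  continues with \<open>N\<close> or \<open>E\<close> according to the mark.\<close>

lemma marking_inject: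
  assumes "map forget_marking w = map forget_marking w'"
    and "top_word w @ replicate m E = top_word w' @ replicate m' E"
  shows "w = w'"
  using map_eq_imp_length_eq[OF assms(1)] assms
proof (induction w w' rule: list_induct2)
  case (Cons x xs y ys)
  have "x = y"
    using Cons.prems by (cases x; cases y) auto
  moreover have "xs = ys"
    using Cons.prems \<open>x = y\<close> by (intro Cons.IH) auto
  ultimately show ?case by simp
qed simp

section \<open>Nestedness and nonnegative gain\<close>

lemma path_prefix_comparable:
  assumes "q1 @ r1 = q2 @ r2" "count_list (q1 :: path) N < count_list q2 N"
  shows "\<exists>t. q2 = q1 @ t"
proof -
  have "prefix q1 q2 \<or> prefix q2 q1"
    using assms(1) by (metis prefixI prefix_same_cases)
  moreover have False if "prefix q2 q1"
    using that assms(2) by (auto simp: prefix_def)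
  ultimately show ?thesis by (auto simp: prefix_def)
qed

lemma ex_prefix_count_E: "m \<le> count_list q E \<Longrightarrow> \<exists>r t. q = r @ t \<and> count_list r E = m"
proof (induction q arbitrary: m)
  case Nil
  then show ?case by simp
next
  case (Cons x q)
  show ?case
  proof (cases "m = 0")
    case True
    then show ?thesis by (intro exI[of _ "[]"] exI[of _ "x # q"]) simp
  next
    case False
    define m' where "m' = (if x = E then m - 1 else m)"
    have "m' \<le> count_list q E"
      using Cons.prems by (auto simp: m'_def split: if_splits)
    then obtain r t where "q = r @ t" "count_list r E = m'"
      using Cons.IH by blast
    then show ?thesis
      using False by (intro exI[of _ "x # r"] exI[of _ t]) (auto simp: m'_def)
  qed
qed

text \<open>After the prefix \<open>u\<close> the top path has the height \<open>y\<close> of the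
  given point but lies \<open>gain u\<close> to its left. Continuing it up to abscissa
  \<open>x\<close> can only raise it, and enough east-steps remain because
  \<open>x \<le> n\<close>.\<close>

lemma nested_if_is_gain_word:
  assumes w: "map forget_marking w \<in> dyck_paths n" and gw: "is_gain_word 0 w"
    and q: "q = top_word w @ q'" "count_list q E = n"
  shows "nested (map forget_marking w) q"
  unfolding nested_def
proof clarify
  fix x y assume xy: "(x, y) \<in> path_points (map forget_marking w)"
  then obtain u' v' where "map forget_marking w = u' @ v'" "x = count_list u' E" "y = count_list u' N"
    by (auto simp: path_points_iff)
  then obtain u v where uv: "w = u @ v" "x = count_list (map forget_marking u) E"
      "y = count_list (map forget_marking u) N"
    by (auto simp: map_eq_append_conv)
  have "x \<le> n"
    using path_points_le[OF xy] w by (simp add: dyck_paths_iff)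
  have "0 \<le> gain u"
    using gw is_gain_word_nonneg[of 0 u] by (simp add: uv is_gain_word_append)
  then have c: "count_list (top_word u) E \<le> x"
    by (simp add: uv count_forget_marking gain_def)
  have qu: "q = top_word u @ (top_word v @ q')"
    using q uv by simp
  have "x - count_list (top_word u) E \<le> count_list (top_word v @ q') E"
    using q(2) \<open>x \<le> n\<close> unfolding qu by (simp only: count_list_append)
  then obtain r t where rt: "top_word v @ q' = r @ t" "count_list r E = x - count_list (top_word u) E"
    using ex_prefix_count_E by blast
  have "(x, y + count_list r N) \<in> path_points q"
    unfolding path_points_iff qu rt(1)
    using c rt(2) uv by (intro exI[of _ "top_word u @ r"] exI[of _ t]) simp
  then show "\<exists>y'. (x, y') \<in> path_points q \<and> y \<le> y'"
    using le_add1 by blast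
qed

text \<open>Only an unmarked north-step can lower the gain. Right after one, a point of the top path
  at least as high as the bottom path has passed the east-step of the piece EN just written, so its
  abscissa bounds the number of unmarked north-steps.\<close>

lemma is_gain_word_if_nested:
  assumes nest: "nested (map forget_marking w) q" and q: "q = top_word w @ q'"
  shows "is_gain_word 0 w"
proof (rule is_gain_wordI)
  fix u v assume uv: "w = u @ v"
  have "0 \<le> gain u"
    using uv
  proof (induction u arbitrary: v rule: rev_induct)
    case (snoc x u)
    have IH: "0 \<le> gain u"
      using snoc.IH[of "x # v"] snoc.prems by simp
    show ?case
    proof (cases "x = N_unmarked")
      case True
      let ?u = "u @ [x]"
      define X Y where "X = count_list (map forget_marking ?u) E" and "Y = count_list (map forget_marking ?u) N"
      have "(X, Y) \<in> path_points (map forget_marking w)"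
        unfolding path_points_iff X_def Y_def
        by (intro exI[of _ "map forget_marking ?u"] exI[of _ "map forget_marking v"]) (simp add: snoc.prems)
      then obtain y' where "(X, y') \<in> path_points q" "Y \<le> y'"
        using nest unfolding nested_def by fastforce
      then obtain r t where rt: "q = r @ t" "X = count_list r E" "Y \<le> count_list r N"
        by (auto simp: path_points_iff)
      have "q = (top_word u @ [E]) @ (N # top_word v @ q')"
        using q snoc.prems True by simp
      then have "(top_word u @ [E]) @ (N # top_word v @ q') = r @ t"
        using rt(1) by simp
      \<comment> \<open>Strictness is essential: it makes \<open>r\<close> an extension of the
        prefix that already contains the new east-step.\<close>
      moreover have "count_list (top_word u @ [E]) N < count_list r N"
        using rt(3) True by (simp add: Y_def)
      ultimately obtain z where "r = (top_word u @ [E]) @ z"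
        using path_prefix_comparable by blast
      then show ?thesis
        using rt(2) True by (simp add: X_def gain_def count_forget_marking)
    next
      case False
      then show ?thesis using IH by (cases x) auto
    qed
  qed simp
  then show "0 \<le> 0 + gain u" by simp
qed

section \<open>East-steps at the top height\<close>

lemma east_steps_N: "east_steps_at_height (Suc h) (N # p) = east_steps_at_height h p"
proof -
  have "{k. k < length (N # p) \<and> (N # p) ! k = E \<and> snd (point_at (N # p) k) = Suc h} =
      Suc ` {k. k < length p \<and> p ! k = E \<and> snd (point_at p k) = h}"
    by (auto simp: point_at_def image_iff less_Suc_eq_0_disj gr0_conv_Suc)
  then show ?thesis
    by (simp only: east_steps_at_height_def card_image inj_Suc)
qed

lemma east_steps_E: "east_steps_at_height (Suc h) (E # p) = east_steps_at_height (Suc h) p"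
proof -
  have "{k. k < length (E # p) \<and> (E # p) ! k = E \<and> snd (point_at (E # p) k) = Suc h} =
      Suc ` {k. k < length p \<and> p ! k = E \<and> snd (point_at p k) = Suc h}"
    by (auto simp: point_at_def image_iff less_Suc_eq_0_disj gr0_conv_Suc)
  then show ?thesis
    by (simp only: east_steps_at_height_def card_image inj_Suc)
qed

lemma east_steps_replicate_E: "east_steps_at_height 0 (replicate m E) = m"
proof -
  have "{k. k < length (replicate m E) \<and> replicate m E ! k = E \<and> snd (point_at (replicate m E) k) = 0} = {..<m}"
    by (auto simp: point_at_def take_replicate)
  then show ?thesis
    by (simp add: east_steps_at_height_def)
qed

lemma east_steps_top_word:
  "east_steps_at_height (count_list (map forget_marking w) N) (top_word w @ replicate m E) = m"
proof (induction w)
  case (Cons x w)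
  then show ?case by (cases x) (simp_all add: east_steps_N east_steps_E)
qed (simp add: east_steps_replicate_E)

definition path_pair :: "marked_step list \<Rightarrow> path \<times> path" where
  "path_pair w = (map forget_marking w, complete_east (top_word w))"

lemma complete_east_top_word:
  "complete_east (top_word w) = top_word w @ replicate (count_list w N_marked) E"
  by (simp add: complete_east_def count_forget_marking)

lemma bij_betw_path_pair: "bij_betw path_pair (gain_words n) (SP n)"
  unfolding bij_betw_def
proof
  show "inj_on path_pair (gain_words n)"
    by (rule inj_onI) (auto simp: path_pair_def complete_east_top_word intro: marking_inject)
  show "path_pair ` gain_words n = SP n"
  proof
    show "path_pair ` gain_words n \<subseteq> SP n"
    proof (rule image_subsetI)
      fix w assume "w \<in> gain_words n"
      then have w: "map forget_marking w \<in> dyck_paths n" "is_gain_word 0 w"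
        by (simp_all add: gain_words_def)
      have "stays_above 0 (top_word w @ replicate (count_list w N_marked) E)"
        using stays_above_top_word[of 0 w 0] w by (simp add: dyck_paths_stays_above_iff)
      then have dyck: "complete_east (top_word w) \<in> dyck_paths n"
        using w(1) by (simp add: complete_east_top_word dyck_paths_stays_above_iff)
      then have "count_list (complete_east (top_word w)) E = n"
        by (simp add: dyck_paths_iff)
      then have "nested (map forget_marking w) (complete_east (top_word w))"
        using nested_if_is_gain_word[OF w] complete_east_top_word by blast
      then show "path_pair w \<in> SP n"
        using w dyck steep_top_word[of w]
        by (simp add: path_pair_def SP_def nested_pairs_def complete_east_top_word)
    qed
    show "SP n \<subseteq> path_pair ` gain_words n"
    proof clarify
      fix p q assume "(p, q) \<in> SP n"
      then have pq: "p \<in> dyck_paths n" "q \<in> dyck_paths n" "nested p q" "steep q"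
        by (auto simp: SP_def nested_pairs_def)
      obtain bs m where q: "q = concat (map (\<lambda>b. top_steps (north b)) bs) @ replicate m E"
        using ex_steep_decomposition[OF pq(4)] by blast
      have "count_list (concat (map (\<lambda>b. top_steps (north b)) bs)) N = length bs"
        by (induction bs) auto
      then have "count_list p N = length bs"
        using pq(1,2) by (simp add: dyck_paths_iff q)
      then obtain w where w: "map forget_marking w = p"
          "top_word w = concat (map (\<lambda>b. top_steps (north b)) bs)"
        using ex_marking by blast
      then have q': "q = top_word w @ replicate m E"
        using q by simp
      have "count_list q E = count_list q N"
        using pq(2) by (simp add: dyck_paths_iff)
      \<comment> \<open>The length of the final run is forced because the top path ends on the
        diagonal, so it is the one that \<open>complete_east\<close> appends.\<close>
      then have "m = count_list w N_marked"
        by (simp add: q' count_forget_marking)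
      then have "path_pair w = (p, q)"
        using w(1) q' by (simp add: path_pair_def complete_east_top_word)
      moreover have "w \<in> gain_words n"
        using pq w is_gain_word_if_nested[OF _ q'] by (simp add: gain_words_def)
      ultimately show "(p, q) \<in> path_pair ` gain_words n"
        by (metis imageI)
    qed
  qed
qed

section \<open>Both statistics as the number of colors\<close>

lemma Xi_steep_eq: "Xi_steep = path_pair \<circ> (\<lambda>(T, \<alpha>). marked_word T \<alpha>)"
  by (auto simp: Xi_steep_def path_pair_def)

lemma Xi_steep_bij: "bij_betw Xi_steep (LAC n) (SP n)"
  unfolding Xi_steep_eq using bij_betw_marked_word bij_betw_path_pair by (rule bij_betw_trans)

lemma Xi_steep_east_steps:
  assumes LAC: "(T, \<alpha>) \<in> LAC n"
  shows "east_steps_at_height n (snd (Xi_steep (T, \<alpha>))) = length \<alpha>"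
proof -
  have "marked_word T \<alpha> \<in> gain_words n"
    using bij_betw_marked_word LAC by (auto simp: bij_betw_def)
  then have "count_list (map forget_marking (marked_word T \<alpha>)) N = n"
    by (simp add: gain_words_def dyck_paths_iff)
  then show ?thesis
    using east_steps_top_word[of "marked_word T \<alpha>"] LAC_count_marked[OF LAC]
    by (simp add: Xi_steep_eq path_pair_def complete_east_top_word)
qed

lemma Xi_bounce_diagonal_contacts:
  assumes "(T, \<alpha>) \<in> LAC n"
  shows "diagonal_contacts (fst (Xi_bounce (T, \<alpha>))) = length \<alpha> + 1"
  using assms colorable_positive[of "kids T" \<alpha>]
  by (simp add: Xi_bounce_def diagonal_contacts_bounce_path LAC_iff)

theorem mainTheorem3:
  fixes n r :: nat
  assumes "n > 0" and "r \<in> {1..n}"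
  shows "bij_betw (Gamma_map n)
           {(\<mu>1, \<mu>2) \<in> SP n. east_steps_at_height n \<mu>2 = r}
           {(\<mu>1, \<mu>2) \<in> BP n. diagonal_contacts \<mu>1 = r + 1}"
proof -
  let ?L = "{(T, \<alpha>) \<in> LAC n. length \<alpha> = r}"
  let ?S = "{(\<mu>1, \<mu>2) \<in> SP n. east_steps_at_height n \<mu>2 = r}"
  let ?B = "{(\<mu>1, \<mu>2) \<in> BP n. diagonal_contacts \<mu>1 = r + 1}"
  note steep = Xi_steep_bij[of n]
  note bounce = Xi_bounce_bij[OF assms(1)]
  have L: "?L \<subseteq> LAC n" by auto
  have "Xi_steep ` ?L = ?S"
  proof -
    have "Xi_steep ` ?L = {p \<in> Xi_steep ` LAC n. east_steps_at_height n (snd p) = r}"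
      using Xi_steep_east_steps by fastforce
    then show ?thesis
      using steep by (auto simp: bij_betw_def)
  qed
  then have inv: "bij_betw (inv_into (LAC n) Xi_steep) ?S ?L"
    by (rule bij_betw_inv_into_subset[OF steep L])
  have "Xi_bounce ` ?L = ?B"
  proof -
    have "Xi_bounce ` ?L = {p \<in> Xi_bounce ` LAC n. diagonal_contacts (fst p) = r + 1}"
      using Xi_bounce_diagonal_contacts by fastforce
    then show ?thesis
      using bounce by (auto simp: bij_betw_def)
  qed
  then have "bij_betw Xi_bounce ?L ?B"
    by (rule bij_betw_subset[OF bounce L])
  with inv show ?thesis
    unfolding Gamma_map_def by (rule bij_betw_trans)
qed

end
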